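(* Let $\Omega\subset\mathbb{R}^3$ be open, bounded and connected with Lipschitz boundary, let $\alpha,\beta,\gamma,K>0$, $f\in C^1(\overline\Omega)$, and let $\varepsilon>0$ be a sufficiently small parameter. Let $\hat J, J, G, F, H, G^*, F^*, B^*, J^*$ be as defined in the context (understood in a finite dimensional finite elements or finite differences approximation). Let $u_0\in U$ satisfy $\delta J(u_0)=\mathbf 0$ and define $$\hat v_0^*=\alpha(u_0^2-\beta),\qquad \hat v^*=\varepsilon u_0+f,\qquad \hat p=u_0 .$$ Then $\delta J^*(\hat v^*,\hat v_0^*,\hat p)=\mathbf 0$. Moreover: (a) If in addition $\delta^2J(u_0)>\mathbf 0$ and $\hat v_0^*\in B^*$, then there exist $r_1,r_2,r_3>0$ such that $$J(u_0)=\inf_{u\in B_{r_1}(u_0)}J(u)=\inf_{v^*\in B_{r_3}(\hat v^* )}\Big\{\inf_{p\in B_{r_2}(\hat p)}\Big\{\sup_{v_0^*\in B^*}J^*(v^*,v_0^*,p)\Big\}\Big\}=J^*(\hat v^*,\hat v_0^*,\hat p).$$ Moreover, defining $J_3^*:B_{r_3}(\hat v^* )\to\mathbb{R}$ by $J_3^*(v^* )=\inf_{p\in B_{r_2}(\hat p)}\{\sup_{v_0^*\in B^*}J^*(v^*,v_0^*,p)\}$, we have $\delta J_3^*(\hat v^* )=\mathbf 0$ and $\delta^2J_3^*(\hat v^* )>\mathbf 0$, so that $$J(u_0)=\inf_{u\in B_{r_1}(u_0)}J(u)=\inf_{v^*\in B_{r_3}(\hat v^* )}J_3^*(v^* )=J_3^*(\hat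 v^* ).$$ (b) If in addition $\delta^2J(u_0)<\mathbf 0$ and $\hat v_0^*\in B^*$, then there exist $r_1,r_2,r_3>0$ such that $$J(u_0)=\sup_{u\in B_{r_1}(u_0)}J(u)=\inf_{v^*\in B_{r_3}(\hat v^* )}\Big\{\sup_{p\in B_{r_2}(\hat p)}\Big\{\sup_{v_0^*\in B^*}J^*(v^*,v_0^*,p)\Big\}\Big\}=J^*(\hat v^*,\hat v_0^*,\hat p).$$ Moreover, defining $J_5^*:B_{r_3}(\hat v^* )\to\mathbb{R}$ by $J_5^*(v^* )=\sup_{p\in B_{r_2}(\hat p)}\{\sup_{v_0^*\in B^*}J^*(v^*,v_0^*,p)\}$, we have $\delta J_5^*(\hat v^* )=\mathbf 0$ and $\delta^2J_5^*(\hat v^* )>\mathbf 0$, so that $$J(u_0)=\sup_{u\in B_{r_1}(u_0)}J(u)=\inf_{v^*\in B_{r_3}(\hat v^* )}J_5^*(v^* )=J_5^*(\hat v^* ).$$ (c) Let $A^+=\{v_0^*\in Y^*: -\gamma\nabla^2+2v_0^*>\mathbf 0\}$. If in addition $\hat v_0^*\in A^+\cap B^*$, then $$J(u_0)=\inf_{u\in U}J(u)=\inf_{(v^*,p)\in Y^*\times Y}\Big\{\sup_{v_0^*\in A^+\cap B^*}J^*(v^*,v_0^*,p)\Big\}=J^*(\hat v^*,\hat v_0^*,\hat p).$$ Moreover, defining $J_7^*:Y^*\times Y\to\mathbb{R}$ by $J_7^*(v^*,p)=\sup_{v_0^*\in A^+\cap B^*}J^*(v^*,v_0^*,p)$, we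 have $\delta J_7^*(\hat v^*,\hat p)=\mathbf 0$ and $\delta^2J_7^*(\hat v^*,\hat p)>\mathbf 0$, so that $$J(u_0)=\inf_{u\in U}J(u)=\inf_{(v^*,p)\in Y^*\times Y}J_7^*(v^*,p)=J_7^*(\hat v^*,\hat p).$$
   Context: Spaces: $U=W_0^{1,2}(\Omega)$, $Y=Y^*=L^2(\Omega)$. Convention: although spaces, functionals and operators are not relabeled, everything is understood for a finite dimensional approximation of the model in a finite elements or finite differences context. Thus $-\gamma\nabla^2$ is a matrix, a function such as $v_0^*$ appearing in an operator expression acts by multiplication, scalars stand for multiples of the identity matrix $I_d$, and inequalities between operators such as $M>\mathbf 0$ or $M>K/2$ are in the sense of symmetric matrices (positive definiteness). For an invertible operator $M$, the notation $\int_\Omega \frac{w^2}{M}\,dx$ means $\langle M^{-1}w,w\rangle$. $\delta$ and $\delta^2$ denote first and second variations (gradient and Hessian), and $B_r(x)$ is the ball of radius $r$ centered at $x$. Functionals: $\hat J:U\times Y\to\mathbb{R}$, $$\hat J(u,p)=\frac{\gamma}{2}\int_\Omega\nabla u\cdot\nabla u\,dx+\frac{\alpha}{2}\int_\Omega(u^2-\beta)^2dx+\frac K2\int_\Omega(u-p)^2dx-\langle u,f\rangle_{L^2},\qquad J(u)=\hat J(u,u).$$ $G:U\times Y\times Y\to\mathbb{R}$, $$G(u,v,p)=\frac{\gamma}{2}\int_\Omega\nabla u\cdot\nabla u\,dx+\frac\alpha2\int_\Omega(u^2-\beta+v)^2dx-\langle u,Kp\rangle_{L^2}+\frac K2\int_\Omega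 u^2dx+\frac\varepsilon2\int_\Omega u^2dx,$$ $F(u)=\frac\varepsilon2\int_\Omega u^2dx+\langle u,f\rangle_{L^2}$ and $H(p)=\frac K2\int_\Omega p^2dx$, so that $\hat J(u,p)=G(u,0,p)-F(u)+H(p)$. $B^*=\{v_0^*\in Y^*: -\gamma\nabla^2+2v_0^*+K+\varepsilon>\frac K2\}$. For $v_0^*\in B^*$, $$G^*(v^*,v_0^*,p)=\sup_{u\in U}\sup_{v\in Y}\{\langle u,v^*\rangle_{L^2}+\langle v,v_0^*\rangle_{L^2}-G(u,v,p)\}=\frac12\int_\Omega\frac{(v^*+Kp)^2}{-\gamma\nabla^2+2v_0^*+K+\varepsilon}dx+\frac1{2\alpha}\int_\Omega(v_0^* )^2dx+\beta\int_\Omega v_0^*dx.$$ $F^*(v^* )=\sup_{u\in Y}\{\langle u,v^*\rangle_{L^2}-F(u)\}=\frac1{2\varepsilon}\int_\Omega(v^*-f)^2dx$. Finally $J^*:Y^*\times B^*\times Y\to\mathbb{R}$ is $$J^*(v^*,v_0^*,p)=-G^*(v^*,v_0^*,p)+F^*(v^* )+H(p).$$ *)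

theory Defs
  imports "HOL-Analysis.Analysis"
begin

text \<open>
  The frontier is locally the graph of a Lipschitz function over the plane orthogonal to a unit
  vector \<open>e\<close>, with the set lying on the side of \<open>e\<close>. The coordinate of \<open>y\<close> in that plane is
  \<open>y - (y \<bullet> e) *\<^sub>R e\<close>.
\<close>

definition lipschitz_boundary :: "(real^3) set \<Rightarrow> bool" where
  "lipschitz_boundary \<Omega> \<longleftrightarrow>
     (\<forall>x\<in>frontier \<Omega>. \<exists>r>0. \<exists>e. \<exists>L. \<exists>\<phi> :: real^3 \<Rightarrow> real.
        norm e = 1 \<and> L-lipschitz_on {y. y \<bullet> e = 0} \<phi> \<and>
        (\<forall>y\<in>ball x r. y \<in> \<Omega> \<longleftrightarrow> \<phi> (y - (y \<bullet> e) *\<^sub>R e) < y \<bullet> e))"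

definition C1_closure :: "(real^3) set \<Rightarrow> (real^3 \<Rightarrow> real) \<Rightarrow> bool" where
  "C1_closure \<Omega> f \<longleftrightarrow> continuous_on (closure \<Omega>) f \<and>
     (\<exists>g. continuous_on (closure \<Omega>) g \<and>
          (\<forall>x\<in>\<Omega>. (f has_derivative (\<lambda>h. g x \<bullet> h)) (at x)))"

text \<open>
  A finite difference or (mass lumped) finite element approximation. Functions, in
  \<open>W\<^sub>0\<^sup>1\<^sup>,\<^sup>2(\<Omega>)\<close> as well as in \<open>L\<^sup>2(\<Omega>)\<close>, are represented by
  their values at the interior nodes, indexed by \<open>'n\<close>, so that they multiply pointwise
  (which is what \<open>*\<close> and \<open>^\<close> mean on \<open>real^'n\<close>). The integral of a function becomes a nodal
  quadrature with weights \<open>wt\<close>. Gradients are constant on each of finitely many cells, indexed by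
  \<open>'m\<close>, of volumes \<open>cell_vol\<close>. Injectivity of the discrete gradient is the discrete counterpart of
  the homogeneous Dirichlet condition.
\<close>

record ('n, 'm) scheme =
  node :: "'n \<Rightarrow> real^3"
  wt :: "'n \<Rightarrow> real"
  cell_vol :: "'m \<Rightarrow> real"
  grad :: "real^'n \<Rightarrow> (real^3)^'m"

definition discretization :: "(real^3) set \<Rightarrow> ('n::finite, 'm::finite) scheme \<Rightarrow> bool" where
  "discretization \<Omega> S \<longleftrightarrow>
     inj (node S) \<and> range (node S) \<subseteq> \<Omega> \<and> (\<forall>i. wt S i > 0) \<and> (\<forall>c. cell_vol S c > 0) \<and>
     linear (grad S) \<and> inj (grad S)"

definition nodal :: "('n::finite, 'm::finite) scheme \<Rightarrow> (real^3 \<Rightarrow> real) \<Rightarrow> real^'n" where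
  "nodal S f = (\<chi> i. f (node S i))"

definition integ :: "('n::finite, 'm::finite) scheme \<Rightarrow> real^'n \<Rightarrow> real" where
  "integ S u = (\<Sum>i\<in>UNIV. wt S i * u $ i)"

definition l2 :: "('n::finite, 'm::finite) scheme \<Rightarrow> real^'n \<Rightarrow> real^'n \<Rightarrow> real" where
  "l2 S u v = integ S (u * v)"

definition dirichlet :: "('n::finite, 'm::finite) scheme \<Rightarrow> real^'n \<Rightarrow> real^'n \<Rightarrow> real" where
  "dirichlet S u v = (\<Sum>c\<in>UNIV. cell_vol S c * (grad S u $ c \<bullet> grad S v $ c))"

text \<open>
  The matrix of \<open>-\<nabla>\<^sup>2\<close>: it represents the Dirichlet form with respect to the discrete
  \<open>L\<^sup>2\<close> inner product, see \<open>l2_neg_laplacian\<close> below.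
\<close>

definition neg_laplacian :: "('n::finite, 'm::finite) scheme \<Rightarrow> real^'n^'n" where
  "neg_laplacian S = (\<chi> i j. dirichlet S (axis i 1) (axis j 1) / wt S i)"

definition mult_op :: "real^'n \<Rightarrow> real^'n^'n::finite" where
  "mult_op v = (\<chi> i j. if i = j then v $ i else 0)"

text \<open>
  The order of self-adjoint operators on the discrete \<open>L\<^sup>2\<close> space. It is the usual order of
  symmetric matrices when the weights are all equal.
\<close>

definition op_less :: "('n::finite, 'm::finite) scheme \<Rightarrow> real^'n^'n \<Rightarrow> real^'n^'n \<Rightarrow> bool" where
  "op_less S A B \<longleftrightarrow> (\<forall>u. u \<noteq> 0 \<longrightarrow> l2 S (A *v u) u < l2 S (B *v u) u)"

definition energy_hat ::
  "('n::finite, 'm::finite) scheme \<Rightarrow> real \<Rightarrow> real \<Rightarrow> real \<Rightarrow> real \<Rightarrow> real^'n \<Rightarrow>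
   real^'n \<Rightarrow> real^'n \<Rightarrow> real" where
  "energy_hat S \<alpha> \<beta> \<gamma> K f u p =
     \<gamma> / 2 * dirichlet S u u + \<alpha> / 2 * integ S ((u^2 - vec \<beta>)^2)
     + K / 2 * integ S ((u - p)^2) - l2 S u f"

definition energy ::
  "('n::finite, 'm::finite) scheme \<Rightarrow> real \<Rightarrow> real \<Rightarrow> real \<Rightarrow> real \<Rightarrow> real^'n \<Rightarrow> real^'n \<Rightarrow> real" where
  "energy S \<alpha> \<beta> \<gamma> K f u = energy_hat S \<alpha> \<beta> \<gamma> K f u u"

definition G_fun ::
  "('n::finite, 'm::finite) scheme \<Rightarrow> real \<Rightarrow> real \<Rightarrow> real \<Rightarrow> real \<Rightarrow> real \<Rightarrow>
   real^'n \<Rightarrow> real^'n \<Rightarrow> real^'n \<Rightarrow> real" where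
  "G_fun S \<alpha> \<beta> \<gamma> K \<epsilon> u v p =
     \<gamma> / 2 * dirichlet S u u + \<alpha> / 2 * integ S ((u^2 - vec \<beta> + v)^2)
     - l2 S u (K *\<^sub>R p) + K / 2 * integ S (u^2) + \<epsilon> / 2 * integ S (u^2)"

definition F_fun :: "('n::finite, 'm::finite) scheme \<Rightarrow> real^'n \<Rightarrow> real \<Rightarrow> real^'n \<Rightarrow> real" where
  "F_fun S f \<epsilon> u = \<epsilon> / 2 * integ S (u^2) + l2 S u f"

definition H_fun :: "('n::finite, 'm::finite) scheme \<Rightarrow> real \<Rightarrow> real^'n \<Rightarrow> real" where
  "H_fun S K p = K / 2 * integ S (p^2)"

definition shifted_op ::
  "('n::finite, 'm::finite) scheme \<Rightarrow> real \<Rightarrow> real \<Rightarrow> real \<Rightarrow> real^'n \<Rightarrow> real^'n^'n" where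
  "shifted_op S \<gamma> K \<epsilon> v0 = \<gamma> *\<^sub>R neg_laplacian S + 2 *\<^sub>R mult_op v0 + mat K + mat \<epsilon>"

definition B_star :: "('n::finite, 'm::finite) scheme \<Rightarrow> real \<Rightarrow> real \<Rightarrow> real \<Rightarrow> (real^'n) set" where
  "B_star S \<gamma> K \<epsilon> = {v0. op_less S (mat (K / 2)) (shifted_op S \<gamma> K \<epsilon> v0)}"

definition A_plus :: "('n::finite, 'm::finite) scheme \<Rightarrow> real \<Rightarrow> (real^'n) set" where
  "A_plus S \<gamma> = {v0. op_less S 0 (\<gamma> *\<^sub>R neg_laplacian S + 2 *\<^sub>R mult_op v0)}"

text \<open>
  Real-valued conjugates. The suprema are those of bounded sets for \<open>v0 \<in> B_star S \<gamma> K \<epsilon>\<close> (for every \<open>v\<close> in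
  the case of \<open>F_star\<close>), see \<open>G_star_eq\<close> and \<open>F_star_eq\<close>; outside \<open>B_star\<close> the value of \<open>G_star\<close> is meaningless.
\<close>

definition G_star ::
  "('n::finite, 'm::finite) scheme \<Rightarrow> real \<Rightarrow> real \<Rightarrow> real \<Rightarrow> real \<Rightarrow> real \<Rightarrow>
   real^'n \<Rightarrow> real^'n \<Rightarrow> real^'n \<Rightarrow> real" where
  "G_star S \<alpha> \<beta> \<gamma> K \<epsilon> v v0 p = (SUP u. SUP w. l2 S u v + l2 S w v0 - G_fun S \<alpha> \<beta> \<gamma> K \<epsilon> u w p)"

definition F_star :: "('n::finite, 'm::finite) scheme \<Rightarrow> real^'n \<Rightarrow> real \<Rightarrow> real^'n \<Rightarrow> real" where
  "F_star S f \<epsilon> v = (SUP u. l2 S u v - F_fun S f \<epsilon> u)"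

definition J_star ::
  "('n::finite, 'm::finite) scheme \<Rightarrow> real \<Rightarrow> real \<Rightarrow> real \<Rightarrow> real \<Rightarrow> real^'n \<Rightarrow> real \<Rightarrow>
   real^'n \<Rightarrow> real^'n \<Rightarrow> real^'n \<Rightarrow> real" where
  "J_star S \<alpha> \<beta> \<gamma> K f \<epsilon> v v0 p =
     - G_star S \<alpha> \<beta> \<gamma> K \<epsilon> v v0 p + F_star S f \<epsilon> v + H_fun S K p"

definition first_variation_zero :: "('a::real_normed_vector \<Rightarrow> real) \<Rightarrow> 'a \<Rightarrow> bool" where
  "first_variation_zero \<Phi> x \<longleftrightarrow> (\<Phi> has_derivative (\<lambda>_. 0)) (at x)"

definition has_hessian :: "('a::euclidean_space \<Rightarrow> real) \<Rightarrow> ('a \<Rightarrow> 'a) \<Rightarrow> 'a \<Rightarrow> bool" where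
  "has_hessian \<Phi> H x \<longleftrightarrow>
     (\<exists>g. (\<forall>\<^sub>F y in nhds x. (\<Phi> has_derivative (\<lambda>h. g y \<bullet> h)) (at y)) \<and> (g has_derivative H) (at x))"

definition second_variation_pos :: "('a::euclidean_space \<Rightarrow> real) \<Rightarrow> 'a \<Rightarrow> bool" where
  "second_variation_pos \<Phi> x \<longleftrightarrow> (\<exists>H. has_hessian \<Phi> H x \<and> (\<forall>h. h \<noteq> 0 \<longrightarrow> H h \<bullet> h > 0))"

definition second_variation_neg :: "('a::euclidean_space \<Rightarrow> real) \<Rightarrow> 'a \<Rightarrow> bool" where
  "second_variation_neg \<Phi> x \<longleftrightarrow> (\<exists>H. has_hessian \<Phi> H x \<and> (\<forall>h. h \<noteq> 0 \<longrightarrow> H h \<bullet> h < 0))"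

lemma dirichlet_linear:
  assumes "discretization \<Omega> S"
  shows "linear (\<lambda>u. dirichlet S u v)" "linear (dirichlet S u)"
proof -
  have g: "linear (grad S)" using assms by (simp add: discretization_def)
  show "linear (\<lambda>u. dirichlet S u v)"
    by (rule linearI) (simp_all add: dirichlet_def linear_add[OF g] linear_scale[OF g]
        inner_add_left sum.distrib sum_distrib_left algebra_simps)
  show "linear (dirichlet S u)"
    by (rule linearI) (simp_all add: dirichlet_def linear_add[OF g] linear_scale[OF g]
        inner_add_right sum.distrib sum_distrib_left algebra_simps)
qed

lemma l2_neg_laplacian:
  assumes S: "discretization \<Omega> S"
  shows "l2 S (neg_laplacian S *v u) v = dirichlet S u v"
proof -
  have e: "x = (\<Sum>i\<in>UNIV. x $ i *\<^sub>R axis i 1)" for x :: "real^'a"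
    by (simp add: vec_eq_iff axis_def if_distrib cong: if_cong)
  have w: "wt S i \<noteq> 0" for i using S by (auto simp: discretization_def dest: spec[of _ i])
  have c: "dirichlet S x y = dirichlet S y x" for x y by (simp add: dirichlet_def inner_commute)
  have "dirichlet S u v = dirichlet S (\<Sum>j\<in>UNIV. u $ j *\<^sub>R axis j 1) (\<Sum>i\<in>UNIV. v $ i *\<^sub>R axis i 1)"
    using e[of u] e[of v] by simp
  also have "\<dots> = (\<Sum>i\<in>UNIV. \<Sum>j\<in>UNIV. v $ i * u $ j * dirichlet S (axis i 1) (axis j 1))"
    by (simp add: linear_sum[OF dirichlet_linear(1)[OF S]] linear_sum[OF dirichlet_linear(2)[OF S]]
        linear_scale[OF dirichlet_linear(1)[OF S]] linear_scale[OF dirichlet_linear(2)[OF S]]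
        sum_distrib_left c mult.assoc)
  also have "\<dots> = l2 S (neg_laplacian S *v u) v"
    by (simp add: l2_def integ_def neg_laplacian_def matrix_vector_mult_def sum_distrib_left
        sum_distrib_right w mult.assoc mult.commute mult.left_commute)
  finally show ?thesis by simp
qed

lemma l2_simps:
  "l2 S (u + v) w = l2 S u w + l2 S v w" "l2 S u (v + w) = l2 S u v + l2 S u w"
  "l2 S (u - v) w = l2 S u w - l2 S v w" "l2 S u (v - w) = l2 S u v - l2 S u w"
  "l2 S (c *\<^sub>R u) v = c * l2 S u v" "l2 S u (c *\<^sub>R v) = c * l2 S u v"
  by (simp_all add: l2_def integ_def algebra_simps sum.distrib sum_subtractf sum_distrib_left)

lemma l2_commute: "l2 S u v = l2 S v u"
  by (simp add: l2_def mult.commute)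

lemma l2_zero [simp]: "l2 S 0 u = 0" "l2 S u 0 = 0"
  by (simp_all add: l2_def integ_def)

lemma mult_op_mult [simp]: "mult_op v *v u = v * u"
  by (simp add: vec_eq_iff mult_op_def matrix_vector_mult_def if_distrib[of "\<lambda>x. x * _"] cong: if_cong)

lemma mat_mult [simp]: "mat c *v u = c *\<^sub>R (u :: real^'n)"
  by (simp add: vec_eq_iff mat_def matrix_vector_mult_def if_distrib[of "\<lambda>x. x * _"] cong: if_cong)

lemma l2_shifted_op:
  assumes "discretization \<Omega> S"
  shows "l2 S (shifted_op S \<gamma> K \<epsilon> v0 *v u) w =
    \<gamma> * dirichlet S u w + 2 * l2 S (v0 * u) w + (K + \<epsilon>) * l2 S u w"
  by (simp add: shifted_op_def matrix_vector_mult_add_rdistrib scaleR_matrix_vector_assoc[symmetric]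
      l2_simps l2_neg_laplacian[OF assms] algebra_simps)

lemma l2_pos:
  assumes "discretization \<Omega> S"
  shows "0 \<le> l2 S u u"
  using assms by (auto simp: l2_def integ_def discretization_def less_imp_le intro!: sum_nonneg)

lemma F_star_eq:
  assumes S: "discretization \<Omega> S" and \<epsilon>: "\<epsilon> > 0"
  shows "F_star S f \<epsilon> v = 1 / (2 * \<epsilon>) * integ S ((v - f)^2)"
proof -
  define u1 where "u1 = (1 / \<epsilon>) *\<^sub>R (v - f)"
  have v: "v = \<epsilon> *\<^sub>R u1 + f" using \<epsilon> by (simp add: u1_def)
  have eq: "l2 S u v - F_fun S f \<epsilon> u = 1 / (2 * \<epsilon>) * integ S ((v - f)^2) - \<epsilon> / 2 * l2 S (u - u1) (u - u1)" for u
    using \<epsilon> unfolding v F_fun_def power2_eq_square l2_def[symmetric]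
    by (simp add: l2_simps l2_commute[of S u1 u] field_simps)
  show ?thesis unfolding F_star_def
  proof (rule cSup_eq_maximum)
    show "1 / (2 * \<epsilon>) * integ S ((v - f)^2) \<in> range (\<lambda>u. l2 S u v - F_fun S f \<epsilon> u)"
      by (rule image_eqI[of _ _ u1]) (simp_all add: eq)
    show "x \<le> 1 / (2 * \<epsilon>) * integ S ((v - f)^2)"
      if "x \<in> range (\<lambda>u. l2 S u v - F_fun S f \<epsilon> u)" for x
      using that \<epsilon> l2_pos[OF S] by (auto simp: eq)
  qed
qed

lemma G_star_eq:
  assumes S: "discretization \<Omega> S" and \<alpha>: "\<alpha> > 0" and K: "K > 0" and v0: "v0 \<in> B_star S \<gamma> K \<epsilon>"
  shows "G_star S \<alpha> \<beta> \<gamma> K \<epsilon> v v0 p =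
    1 / 2 * l2 S (matrix_inv (shifted_op S \<gamma> K \<epsilon> v0) *v (v + K *\<^sub>R p)) (v + K *\<^sub>R p)
    + 1 / (2 * \<alpha>) * integ S (v0^2) + \<beta> * integ S v0"
proof -
  define M where "M = shifted_op S \<gamma> K \<epsilon> v0"
  define z where "z = v + K *\<^sub>R p"
  define u1 where "u1 = matrix_inv M *v z"
  define c where "c = 1 / (2 * \<alpha>) * integ S (v0^2) + \<beta> * integ S v0"
  have pos: "0 < l2 S (M *v u) u" if "u \<noteq> 0" for u
  proof -
    have "K / 2 * l2 S u u < l2 S (M *v u) u"
      using v0 that by (auto simp: B_star_def op_less_def M_def l2_simps)
    moreover have "0 \<le> K / 2 * l2 S u u" using K l2_pos[OF S] by simp
    ultimately show ?thesis by linarith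
  qed
  have "inj ((*v) M)"
  proof (rule injI)
    fix x y assume "M *v x = M *v y"
    then have "M *v (x - y) = 0" by (simp add: matrix_vector_mult_diff_distrib)
    then have "l2 S (M *v (x - y)) (x - y) = 0" by simp
    then show "x = y" using pos[of "x - y"] by auto
  qed
  then have "invertible M"
    using matrix_left_invertible_injective[of M] invertible_left_inverse[of M] by simp
  then have "\<exists>N. M ** N = mat 1 \<and> N ** M = mat 1" by (simp add: invertible_def)
  then have "M ** matrix_inv M = mat 1" unfolding matrix_inv_def by (rule someI2_ex) simp
  then have Mu1: "M *v u1 = z"
    by (simp add: u1_def matrix_vector_mul_assoc)
  have sym: "l2 S (M *v x) y = l2 S (M *v y) x" for x y
    unfolding M_def l2_shifted_op[OF S]
    by (simp add: dirichlet_def inner_commute l2_def mult.commute mult.left_commute)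
  have inner: "(SUP w. l2 S u v + l2 S w v0 - G_fun S \<alpha> \<beta> \<gamma> K \<epsilon> u w p)
      = l2 S u z - 1 / 2 * l2 S (M *v u) u + c" for u
  proof -
    define w1 where "w1 = (1 / \<alpha>) *\<^sub>R v0 - u^2 + vec \<beta>"
    have v0': "v0 = \<alpha> *\<^sub>R (w1 + u^2 - vec \<beta>)" using \<alpha> by (simp add: w1_def)
    have b: "integ S x = l2 S x 1" for x by (simp add: l2_def)
    have vb: "vec \<beta> = \<beta> *\<^sub>R (1 :: real^'a)" by (simp add: vec_eq_iff)
    have vu: "l2 S (v0 * u) u = l2 S v0 (u^2)"
      by (simp add: l2_def power2_eq_square mult.assoc)
    have eq: "l2 S u v + l2 S w v0 - G_fun S \<alpha> \<beta> \<gamma> K \<epsilon> u w p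
        = l2 S u z - 1 / 2 * l2 S (M *v u) u + c - \<alpha> / 2 * l2 S (w - w1) (w - w1)" for w
    proof -
      define q where "q = u * u"
      have q: "u^2 = q" by (simp add: q_def power2_eq_square)
      have qq: "l2 S u u = integ S q" by (simp add: l2_def q_def)
      have sq: "integ S (x^2) = l2 S x x" for x by (simp add: l2_def power2_eq_square)
      have cc: "c = 1 / (2 * \<alpha>) * l2 S v0 v0 + \<beta> * l2 S v0 1" by (simp only: c_def sq b[of v0])
      have k: "\<alpha> / 2 * l2 S (q - vec \<beta> + w) (q - vec \<beta> + w)
          = l2 S w v0 + l2 S v0 q - c + \<alpha> / 2 * l2 S (w - w1) (w - w1)"
        using \<alpha> unfolding cc v0' q vb
        by (simp add: l2_simps l2_commute[of S w1 w] l2_commute[of S q w] l2_commute[of S w1 q]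
            l2_commute[of S 1 q] l2_commute[of S 1 w] l2_commute[of S 1 w1] field_simps)
      show ?thesis unfolding G_fun_def M_def l2_shifted_op[OF S] vu sq z_def q k
        by (simp add: l2_simps qq field_simps)
    qed
    show ?thesis
    proof (rule cSup_eq_maximum)
      show "l2 S u z - 1 / 2 * l2 S (M *v u) u + c
          \<in> range (\<lambda>w. l2 S u v + l2 S w v0 - G_fun S \<alpha> \<beta> \<gamma> K \<epsilon> u w p)"
        by (rule image_eqI[of _ _ w1]) (simp_all add: eq)
      show "x \<le> l2 S u z - 1 / 2 * l2 S (M *v u) u + c"
        if "x \<in> range (\<lambda>w. l2 S u v + l2 S w v0 - G_fun S \<alpha> \<beta> \<gamma> K \<epsilon> u w p)" for x
        using that \<alpha> l2_pos[OF S] by (auto simp: eq)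
    qed
  qed
  have outer: "l2 S u z - 1 / 2 * l2 S (M *v u) u + c
      = 1 / 2 * l2 S u1 z + c - 1 / 2 * l2 S (M *v (u - u1)) (u - u1)" for u
    using sym[of u u1] sym[of u1 u] l2_commute[of S z u] l2_commute[of S z u1]
    by (simp add: matrix_vector_mult_diff_distrib l2_simps Mu1 field_simps)
  have nn: "0 \<le> l2 S (M *v u) u" for u
    using pos[of u] by (cases "u = 0") auto
  have "(SUP u. l2 S u z - 1 / 2 * l2 S (M *v u) u + c) = 1 / 2 * l2 S u1 z + c"
  proof (rule cSup_eq_maximum)
    show "1 / 2 * l2 S u1 z + c \<in> range (\<lambda>u. l2 S u z - 1 / 2 * l2 S (M *v u) u + c)"
      by (rule image_eqI[of _ _ u1]) (simp_all add: Mu1 l2_commute[of S u1 z])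
    show "x \<le> 1 / 2 * l2 S u1 z + c"
      if "x \<in> range (\<lambda>u. l2 S u z - 1 / 2 * l2 S (M *v u) u + c)" for x
    proof -
      from that obtain u where u: "x = l2 S u z - 1 / 2 * l2 S (M *v u) u + c" by blast
      show ?thesis unfolding u outer using nn[of "u - u1"] by linarith
    qed
  qed
  then show ?thesis unfolding G_star_def inner by (simp add: u1_def z_def c_def M_def)
qed

end

theory Submission
  imports Defs
begin

text \<open>
  For \<open>v0 \<in> B\<close> completing squares gives, for every \<open>u\<close>,
  \<open>J\<^sup>*(v, v0, p) = R(u, v, p) - |v0 - \<alpha>(u\<^sup>2 - \<beta>)|\<^sup>2 / (2 \<alpha>) - \<langle>M\<^sup>-\<^sup>1 r, r\<rangle> / 2\<close>, where
  \<open>R(u, v, p) = J(u) + K |u - p|\<^sup>2 / 2 + |v - f - \<epsilon> u|\<^sup>2 / (2 \<epsilon>)\<close>, \<open>M\<close> is the shifted operator at \<open>v0\<close>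
  and \<open>r = v + K p - M u\<close>. So \<open>R\<close> dominates the supremum over \<open>v0\<close>, and equals it when \<open>u\<close> solves
  the Euler equation \<open>M u = v + K p\<close> with \<open>v0 = \<alpha>(u\<^sup>2 - \<beta>) \<in> B\<close>. That equation, and the one for the
  stationary \<open>p\<close>, are solved near \<open>u0\<close> by the inverse function theorem; the resulting dual
  functions are conjugates up to quadratic terms, and their signs are read off the exact second order Taylor
  formula of the quartic energy.

  Part (b) needs \<open>\<delta>\<^sup>2 J(u0) + \<epsilon> < 0\<close>, with \<open>\<epsilon>\<close> chosen before \<open>u0\<close>. This is possible because
  the critical set is finite: there each \<open>u $ i ^ 3\<close> is an affine function of \<open>u\<close>.
\<close>

section \<open>Calculus tools: bilinear products, local inverses, derivatives by domination\<close>

lemma bounded_bilinear_vec_times: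
  "bounded_bilinear ((*) :: real^'n::finite \<Rightarrow> real^'n \<Rightarrow> real^'n)"
  by (subst bilinear_conv_bounded_bilinear[symmetric])
    (auto simp: bilinear_def linear_iff algebra_simps vec_eq_iff)

lemma bounded_bilinear_l2:
  "bounded_bilinear (l2 S :: real^'n::finite \<Rightarrow> real^'n \<Rightarrow> real)"
  by (subst bilinear_conv_bounded_bilinear[symmetric])
    (simp add: bilinear_def linear_iff l2_simps)

text \<open>In finite dimension, continuity of \<open>D x h\<close> in \<open>x\<close> for each
  fixed \<open>h\<close> gives continuity in operator norm, and an injective \<open>D x0\<close> is
  invertible, so the inverse function theorem applies. The derivative of the inverse is recorded
  only through \<open>D (G z) (D' h) = h\<close>, the form in which it is used later.\<close>

lemma local_inverse:
  fixes F :: "'a::euclidean_space \<Rightarrow> 'a" and D :: "'a \<Rightarrow> 'a \<Rightarrow> 'a"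
  assumes der: "\<And>x. (F has_derivative D x) (at x)"
    and cont: "\<And>h. continuous_on UNIV (\<lambda>x. D x h)"
    and inj: "inj (D x0)"
  obtains U V G where "open U" "x0 \<in> U" "open V" "F x0 \<in> V"
    "\<And>x. x \<in> U \<Longrightarrow> F x \<in> V" "\<And>x. x \<in> U \<Longrightarrow> G (F x) = x"
    "\<And>z. z \<in> V \<Longrightarrow> G z \<in> U" "\<And>z. z \<in> V \<Longrightarrow> F (G z) = z"
    "\<And>z. z \<in> V \<Longrightarrow> \<exists>D'. (G has_derivative D') (at z) \<and> (\<forall>h. D (G z) (D' h) = h)"
proof -
  define B where "B x = Blinfun (D x)" for x
  have B: "blinfun_apply (B x) = D x" for x
    unfolding B_def using der has_derivative_bounded_linear by (blast intro: bounded_linear_Blinfun_apply)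
  have lin: "linear (D x0)" using der has_derivative_linear by blast
  obtain L where L: "linear L" "L \<circ> D x0 = id"
    using linear_injective_left_inverse[OF lin inj] by blast
  have LB: "blinfun_apply (Blinfun L) = L"
    using L(1) by (simp add: bounded_linear_Blinfun_apply linear_conv_bounded_linear)
  have inv: "Blinfun L o\<^sub>L B x0 = id_blinfun"
    by (rule blinfun_eqI) (use L(2) in \<open>simp add: B LB o_def fun_eq_iff\<close>)
  have contB: "continuous_on UNIV B"
    by (rule continuous_on_blinfun_componentwise) (simp add: B cont)
  obtain U V G G' where *: "open U" "x0 \<in> U" "open V" "F x0 \<in> V" "homeomorphism U V F G"
      "\<And>y. y \<in> V \<Longrightarrow> (G has_derivative (G' y)) (at y)"
      "\<And>y. y \<in> V \<Longrightarrow> G' y = inv (blinfun_apply (B (G y)))"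
      "\<And>y. y \<in> V \<Longrightarrow> bij (blinfun_apply (B (G y)))"
    by (rule inverse_function_theorem[of UNIV F B x0 "Blinfun L"]) (use der contB inv B in auto)
  have "D (G z) (G' z h) = h" if "z \<in> V" for z h
    using *(7,8)[OF that] by (simp add: B bij_is_surj surj_f_inv_f)
  then have "\<exists>D'. (G has_derivative D') (at z) \<and> (\<forall>h. D (G z) (D' h) = h)" if "z \<in> V" for z
    using *(6)[OF that] that by blast
  then show thesis
    using *(1-5) by (intro that[of U V G]) (auto simp: homeomorphism_def)
qed

text \<open>A bound \<open>Q\<close> that vanishes at \<open>x\<close> together with its derivative
  is of smaller order than \<open>norm (y - x)\<close>, hence so is the increment of
  \<open>\<Phi>\<close>. This allows differentiating the dual functional at a critical point without
  differentiating a matrix inverse.\<close>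

lemma has_derivative_zero_dominated:
  fixes \<Phi> Q :: "'a::real_normed_vector \<Rightarrow> real"
  assumes "open A" "x \<in> A"
    and le: "\<And>y. y \<in> A \<Longrightarrow> \<bar>\<Phi> y - \<Phi> x\<bar> \<le> Q y" and "Q x = 0"
    and Q: "(Q has_derivative (\<lambda>_. 0)) (at x)"
  shows "(\<Phi> has_derivative (\<lambda>_. 0)) (at x)"
proof -
  have "((\<lambda>y. \<bar>Q y\<bar> / norm (y - x)) \<longlongrightarrow> 0) (at x)"
    using Q assms(4) by (simp add: has_derivative_iff_norm)
  moreover have "\<forall>\<^sub>F y in at x. norm (\<bar>\<Phi> y - \<Phi> x\<bar> / norm (y - x)) \<le> \<bar>Q y\<bar> / norm (y - x)"
    using eventually_at_in_open'[OF assms(1,2)]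
    by eventually_elim (auto intro!: divide_right_mono order_trans[OF le abs_ge_self])
  ultimately have "((\<lambda>y. \<bar>\<Phi> y - \<Phi> x\<bar> / norm (y - x)) \<longlongrightarrow> 0) (at x)"
    by (rule Lim_null_comparison[rotated])
  then show ?thesis by (simp add: has_derivative_iff_norm bounded_linear_zero)
qed

section \<open>Finiteness of the solution set of a cubic system\<close>

text \<open>
  On the solution set every monomial reduces to a combination of monomials of degree at most \<open>2\<close> in
  each variable, so the solutions map injectively to an independent set in a space of dimension
  \<open>4 ^ CARD('n)\<close>; the exponents \<open>0, 1, 2\<close> are encoded by pairs of booleans.
\<close>

lemma finite_cubic_system:
  fixes Z :: "(real^'n::finite) set"
  assumes cubic: "\<And>u i. u \<in> Z \<Longrightarrow> u $ i ^ 3 = c i + (\<Sum>j\<in>UNIV. a i j * u $ j)"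
  shows "finite Z"
proof -
  define mono where "mono m u = (\<Prod>i\<in>UNIV. u $ i ^ m i)" for m :: "'n \<Rightarrow> nat" and u :: "real^'n"
  define e :: "real^'n \<Rightarrow> real^('n \<Rightarrow> bool \<times> bool)" where
    "e u = (\<chi> k. mono (\<lambda>i. of_bool (fst (k i)) + of_bool (snd (k i))) u)" for u
  \<comment> \<open>These functions agree on \<open>Z\<close> with a linear functional of the
    reduced monomials; the first goal is to place every monomial among them.\<close>
  define V where "V = {h :: real^'n \<Rightarrow> real. \<exists>b. \<forall>u\<in>Z. h u = b \<bullet> e u}"
  have V_add: "(\<lambda>u. g u + h u) \<in> V" if "g \<in> V" "h \<in> V" for g h
    using that unfolding V_def by (auto simp: inner_add_left[symmetric])
  have V_scale: "(\<lambda>u. r * h u) \<in> V" if "h \<in> V" for r h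
    using that unfolding V_def by (auto simp: inner_scaleR_left[symmetric] simp del: inner_scaleR_left)
  have V_cong: "g \<in> V" if "h \<in> V" "\<And>u. u \<in> Z \<Longrightarrow> g u = h u" for g h
    using that unfolding V_def by auto
  have V_0: "(\<lambda>u. 0) \<in> V" unfolding V_def by (auto intro: exI[of _ 0])
  have V_sum: "(\<lambda>u. \<Sum>j\<in>I. h j u) \<in> V" if "finite I" "\<And>j. j \<in> I \<Longrightarrow> h j \<in> V" for I :: "'n set" and h
    using that by (induction I rule: finite_induct) (auto intro: V_0 V_add)
  have mono_add: "mono (\<lambda>i. m i + m' i) u = mono m u * mono m' u" for m m' u
    by (simp add: mono_def power_add prod.distrib)
  have mono_single: "mono (\<lambda>i. if i = j then k else 0) u = u $ j ^ k" for j k u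
    by (simp add: mono_def if_distrib[of "\<lambda>k. _ ^ k"] cong: if_cong)
  have mono_V: "mono m \<in> V" for m
  proof (induction "\<Sum>i\<in>UNIV. m i" arbitrary: m rule: less_induct)
    case less
    show ?case
    proof (cases "\<forall>i. m i \<le> 2")
      case True
      define k where "k i = (m i \<ge> 1, m i \<ge> 2)" for i
      have "m i = of_bool (fst (k i)) + of_bool (snd (k i))" for i
        using True[rule_format, of i] by (auto simp: k_def)
      then have "mono m u = axis k 1 \<bullet> e u" for u
        unfolding inner_axis' e_def by (simp add: mono_def)
      then show ?thesis unfolding V_def by blast
    next
      case False
      then obtain i where "\<not> m i \<le> 2" by blast
      then have i: "m i \<ge> 3" by simp
      \<comment> \<open>Trading the cube of \<open>u $ i\<close> for an affine function lowers the
        total degree by at least \<open>2\<close>, so the induction on the total degree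
        applies.\<close>
      define m' where "m' = m(i := m i - 3)"
      have m: "m = (\<lambda>l. m' l + (if l = i then 3 else 0))" using i by (auto simp: m'_def fun_eq_iff)
      have sum_m: "(\<Sum>l\<in>UNIV. m l) = (\<Sum>l\<in>UNIV. m' l) + 3"
        unfolding m by (simp add: sum.distrib)
      have "mono m' \<in> V" by (rule less) (simp add: sum_m)
      moreover have "mono (\<lambda>l. m' l + (if l = j then 1 else 0)) \<in> V" for j
        by (rule less) (simp add: sum_m sum.distrib)
      ultimately have "(\<lambda>u. c i * mono m' u
          + (\<Sum>j\<in>UNIV. a i j * mono (\<lambda>l. m' l + (if l = j then 1 else 0)) u)) \<in> V"
        by (intro V_add V_scale V_sum) auto
      then show ?thesis
      proof (rule V_cong)
        fix u assume "u \<in> Z"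
        have "mono m u = mono m' u * u $ i ^ 3"
          by (subst m) (simp only: mono_add mono_single)
        also have "\<dots> = c i * mono m' u + (\<Sum>j\<in>UNIV. a i j * (mono m' u * u $ j))"
          by (simp add: cubic[OF \<open>u \<in> Z\<close>] algebra_simps sum_distrib_left)
        finally show "mono m u = c i * mono m' u
          + (\<Sum>j\<in>UNIV. a i j * mono (\<lambda>l. m' l + (if l = j then 1 else 0)) u)"
          by (simp only: mono_add mono_single power_one_right)
      qed
    qed
  qed
  have card_le: "card X \<le> DIM(real^('n \<Rightarrow> bool \<times> bool))" if X: "finite X" "X \<subseteq> Z" for X
  proof -
    have sep: "\<exists>b. b \<bullet> e u \<noteq> 0 \<and> (\<forall>x\<in>X - {u}. b \<bullet> e x = 0)" if u: "u \<in> X" for u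
    proof -
      have "\<exists>i. x \<noteq> u \<longrightarrow> x $ i \<noteq> u $ i" for x by (auto simp: vec_eq_iff)
      \<comment> \<open>Each \<open>x\<close> differs from \<open>u\<close> in coordinate
        \<open>d x\<close>, so the product of the factors \<open>v $ d x - x $ d x\<close> is a
        Lagrange interpolation polynomial: zero on \<open>X - {u}\<close> and nonzero at
        \<open>u\<close>.\<close>
      then obtain d where d: "\<And>x. x \<noteq> u \<Longrightarrow> x $ d x \<noteq> u $ d x" by metis
      \<comment> \<open>The free monomial factor makes the induction go through: it absorbs the
        coordinate brought in by each new linear factor.\<close>
      have "\<forall>m. (\<lambda>v. (\<Prod>x\<in>Y. v $ d x - x $ d x) * mono m v) \<in> V" if "finite Y" for Y
        using that
      proof (induction Y rule: finite_induct)
        case empty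
        show ?case by (simp add: mono_V)
      next
        case (insert y Y)
        show ?case
        proof
          fix m
          have "(\<lambda>v. (\<Prod>x\<in>Y. v $ d x - x $ d x) * mono (\<lambda>l. m l + (if l = d y then 1 else 0)) v
              + (- (y $ d y)) * ((\<Prod>x\<in>Y. v $ d x - x $ d x) * mono m v)) \<in> V"
            using insert.IH by (intro V_add V_scale) auto
          then show "(\<lambda>v. (\<Prod>x\<in>insert y Y. v $ d x - x $ d x) * mono m v) \<in> V"
            by (rule V_cong) (use insert in \<open>simp add: mono_add mono_single algebra_simps\<close>)
        qed
      qed
      then have "(\<lambda>v. (\<Prod>x\<in>X - {u}. v $ d x - x $ d x) * mono (\<lambda>_. 0) v) \<in> V"
        using X by blast
      then obtain b where b: "\<And>v. v \<in> Z \<Longrightarrow> (\<Prod>x\<in>X - {u}. v $ d x - x $ d x) = b \<bullet> e v"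
        unfolding V_def by (auto simp: mono_def)
      have "b \<bullet> e u \<noteq> 0" using b[of u] u X d by fastforce
      moreover have "b \<bullet> e x = 0" if x: "x \<in> X - {u}" for x
      proof -
        have "(\<Prod>y\<in>X - {u}. x $ d y - y $ d y) = 0"
          by (rule prod_zero) (use X(1) x in auto)
        then show ?thesis using b[of x] x X(2) by auto
      qed
      ultimately show ?thesis by blast
    qed
    have "inj_on e X"
    proof (rule inj_onI, rule ccontr)
      fix x y assume "x \<in> X" "y \<in> X" "e x = e y" "x \<noteq> y"
      then show False using sep[of x] by force
    qed
    \<comment> \<open>The separating functionals are dual, up to scale, to the vectors
      \<open>e u\<close>, so none of these lies in the span of the others.\<close>
    moreover have "independent (e ` X)"
      unfolding dependent_def
    proof safe
      fix u assume u: "u \<in> X" "e u \<in> span (e ` X - {e u})"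
      obtain b where b: "b \<bullet> e u \<noteq> 0" "\<And>x. x \<in> X - {u} \<Longrightarrow> b \<bullet> e x = 0" using sep[OF u(1)] by blast
      have "b \<bullet> y = 0" if "y \<in> span (e ` X - {e u})" for y
        using that by (induction rule: span_induct_alt) (auto simp: inner_add_right intro: b(2))
      then show False using u b by blast
    qed
    ultimately show ?thesis using independent_bound[of "e ` X"] by (simp add: card_image)
  qed
  show ?thesis
  proof (rule ccontr)
    assume "infinite Z"
    then obtain X where "X \<subseteq> Z" "finite X" "card X = Suc (DIM(real^('n \<Rightarrow> bool \<times> bool)))"
      using infinite_arbitrarily_large by blast
    then show False using card_le[of X] by simp
  qed
qed

section \<open>The weighted inner product and openness of definiteness\<close>

lemma integ_simps:
  "integ S (x + y) = integ S x + integ S y" "integ S (x - y) = integ S x - integ S y"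
  "integ S (c *\<^sub>R x) = c * integ S x"
  by (simp_all add: integ_def algebra_simps sum.distrib sum_subtractf sum_distrib_left)

lemma vec_eq_scaleR_one: "vec c = c *\<^sub>R (1 :: real^'n::finite)"
  by (simp add: vec_eq_iff)

lemma dirichlet_commute: "dirichlet S u v = dirichlet S v u"
  by (simp add: dirichlet_def inner_commute)

lemma l2_mult_left: "l2 S (x * y) z = l2 S y (x * z)"
  by (simp add: l2_def mult.commute mult.left_commute)

text \<open>Variations are represented by the Euclidean inner product, the operators by the weighted
  one; this conversion moves the weights into the gradient.\<close>

lemma l2_eq_inner: "l2 S u v = ((\<chi> i. wt S i) * u) \<bullet> v"
  by (simp add: l2_def integ_def inner_vec_def mult.assoc)

lemma l2_nondegenerate:
  assumes "discretization \<Omega> S" "u \<noteq> 0"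
  shows "0 < l2 S u u"
proof -
  obtain i where i: "u $ i \<noteq> 0" using assms(2) by (auto simp: vec_eq_iff)
  have w: "0 < wt S k" for k using assms(1) by (simp add: discretization_def)
  have "0 < wt S i * (u $ i * u $ i)"
    using i not_real_square_gt_zero[of "u $ i"] mult_pos_pos[OF w] by blast
  then have "0 < (\<Sum>i\<in>UNIV. wt S i * (u $ i * u $ i))"
    by (intro sum_pos2[of _ i]) (auto simp: w less_imp_le)
  then show ?thesis by (simp add: l2_def integ_def)
qed

text \<open>By homogeneity it is enough to test \<open>u\<close> on the unit sphere. The complement
  is then the projection of a closed set along a compact factor, hence closed.\<close>

lemma open_all_sphere:
  fixes q :: "'a::euclidean_space \<Rightarrow> 'b::euclidean_space \<Rightarrow> real"
  assumes cont: "continuous_on UNIV (\<lambda>(y, u). q y u)"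
    and hom: "\<And>y c u. q y (c *\<^sub>R u) = c\<^sup>2 * q y u"
  shows "open {y. \<forall>u. u \<noteq> 0 \<longrightarrow> 0 < q y u}"
proof -
  have eq: "{y. \<forall>u. u \<noteq> 0 \<longrightarrow> 0 < q y u} = {y. \<forall>u\<in>sphere 0 1. 0 < q y u}"
  proof (intro Collect_cong iffI ballI allI impI)
    fix y u assume *: "\<forall>u\<in>sphere 0 1. 0 < q y u" and u: "(u::'b) \<noteq> 0"
    have "q y u = (norm u)\<^sup>2 * q y (inverse (norm u) *\<^sub>R u)"
      using u hom[of y "norm u" "inverse (norm u) *\<^sub>R u"] by simp
    moreover have "0 < q y (inverse (norm u) *\<^sub>R u)" using * u by simp
    ultimately show "0 < q y u" using u by simp
  next
    fix y u assume "\<forall>u. u \<noteq> 0 \<longrightarrow> 0 < q y u" "(u::'b) \<in> sphere 0 1"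
    moreover from this(2) have "u \<noteq> 0" by auto
    ultimately show "0 < q y u" by blast
  qed
  have "continuous_on UNIV (\<lambda>z. q (snd z) (fst z))"
    using continuous_on_compose2[OF cont continuous_on_swap] by (simp add: prod.swap_def)
  then have "closed {z. q (snd z) (fst z) \<le> 0}"
    by (intro closed_Collect_le) auto
  then have "closed {y. \<exists>u. u \<in> sphere 0 1 \<and> (u, y) \<in> {z. q (snd z) (fst z) \<le> 0}}"
    by (intro closed_compact_projection compact_sphere)
  also have "{y. \<exists>u. u \<in> sphere 0 1 \<and> (u, y) \<in> {z. q (snd z) (fst z) \<le> 0}}
      = - {y. \<forall>u\<in>sphere 0 1. 0 < q y u}"
    by (auto simp: not_less simp del: mem_sphere mem_sphere_0)
  finally show ?thesis unfolding eq by (simp add: closed_def)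
qed

section \<open>The quartic potential: definiteness, exact Taylor formula, local inversion of the
  gradient\<close>

locale discrete_energy =
  fixes \<Omega> :: "(real^3) set" and S :: "('n::finite, 'm::finite) scheme" and \<alpha> \<beta> \<gamma> :: real
    and f :: "real^'n"
  assumes disc: "discretization \<Omega> S" and \<alpha>_pos: "\<alpha> > 0"
begin

abbreviation L2 :: "real^'n \<Rightarrow> real^'n \<Rightarrow> real" where "L2 \<equiv> l2 S"

text \<open>The form of the operator \<open>- \<gamma> \<nabla>\<^sup>2 + 2 y\<close>. The operators
  in \<open>A_plus\<close>, \<open>B_star\<close> and the Hessians all have this shape, so every
  order relation becomes a condition on the weight \<open>y\<close>.\<close>

definition quad :: "real^'n \<Rightarrow> real^'n \<Rightarrow> real" where
  "quad y u = \<gamma> * dirichlet S u u + 2 * L2 (y * u) u"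

text \<open>One family covers three functions: up to linear and constant terms in \<open>u\<close>,
  \<open>c = 0\<close> gives the energy, \<open>c = K + \<epsilon>\<close> the majorant of the dual
  functional at fixed \<open>v\<close> and \<open>p\<close>, and \<open>c = \<epsilon>\<close> that
  majorant on the diagonal \<open>p = u\<close>.\<close>

definition pot :: "real \<Rightarrow> real^'n \<Rightarrow> real" where
  "pot c u = \<gamma> / 2 * dirichlet S u u + \<alpha> / 2 * integ S ((u\<^sup>2 - vec \<beta>)\<^sup>2) + c / 2 * L2 u u"

definition grad_pot :: "real \<Rightarrow> real^'n \<Rightarrow> real^'n" where
  "grad_pot c u = \<gamma> *\<^sub>R (neg_laplacian S *v u) + (2 * \<alpha>) *\<^sub>R ((u * u - vec \<beta>) * u) + c *\<^sub>R u"

text \<open>The constant \<open>c\<close> enters halved because \<open>quad\<close> doubles its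
  weight.\<close>

definition hess_weight :: "real \<Rightarrow> real^'n \<Rightarrow> real^'n" where
  "hess_weight c u = \<alpha> *\<^sub>R (3 *\<^sub>R (u * u) - vec \<beta>) + vec (c / 2)"

definition hess_pot :: "real \<Rightarrow> real^'n \<Rightarrow> real^'n \<Rightarrow> real^'n" where
  "hess_pot c u h = \<gamma> *\<^sub>R (neg_laplacian S *v h) + 2 *\<^sub>R (hess_weight c u * h)"

definition Pos :: "(real^'n) set" where "Pos = {y. \<forall>u. u \<noteq> 0 \<longrightarrow> 0 < quad y u}"
definition Neg :: "(real^'n) set" where "Neg = {y. \<forall>u. u \<noteq> 0 \<longrightarrow> quad y u < 0}"

lemmas lin_dirichlet = dirichlet_linear[OF disc]

lemma dirichlet_simps:
  "dirichlet S (u + v) w = dirichlet S u w + dirichlet S v w"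
  "dirichlet S w (u + v) = dirichlet S w u + dirichlet S w v"
  "dirichlet S (u - v) w = dirichlet S u w - dirichlet S v w"
  "dirichlet S w (u - v) = dirichlet S w u - dirichlet S w v"
  "dirichlet S (c *\<^sub>R u) w = c * dirichlet S u w"
  "dirichlet S w (c *\<^sub>R u) = c * dirichlet S w u"
  by (simp_all add: linear_add[OF lin_dirichlet(1)] linear_add[OF lin_dirichlet(2)]
      linear_diff[OF lin_dirichlet(1)] linear_diff[OF lin_dirichlet(2)]
      linear_scale[OF lin_dirichlet(1)] linear_scale[OF lin_dirichlet(2)])

lemma bounded_bilinear_dirichlet: "bounded_bilinear (dirichlet S)"
  by (subst bilinear_conv_bounded_bilinear[symmetric])
    (simp add: bilinear_def linear_iff dirichlet_simps)

lemma L2_hess_pot: "L2 (hess_pot c u h) k = \<gamma> * dirichlet S h k + 2 * L2 (hess_weight c u * h) k"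
  by (simp add: hess_pot_def l2_simps l2_neg_laplacian[OF disc])

lemma L2_hess_pot_self: "L2 (hess_pot c u h) h = quad (hess_weight c u) h"
  by (simp add: L2_hess_pot quad_def)

lemma quad_shift: "quad (y + vec (c / 2)) u = quad y u + c * L2 u u"
  by (simp add: quad_def vec_eq_scaleR_one distrib_right l2_simps algebra_simps)

lemma hess_pot_shift: "hess_pot c u h = hess_pot 0 u h + c *\<^sub>R h"
  by (simp add: hess_pot_def hess_weight_def vec_eq_iff algebra_simps)

lemma grad_pot_shift: "grad_pot c u = grad_pot 0 u + c *\<^sub>R u"
  by (simp add: grad_pot_def)

lemma cont_quad: "continuous_on UNIV (\<lambda>(y, u). quad y u)"
  unfolding quad_def case_prod_unfold
  by (intro continuous_intros bounded_bilinear.continuous_on[OF bounded_bilinear_dirichlet]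
      bounded_bilinear.continuous_on[OF bounded_bilinear_l2]
      bounded_bilinear.continuous_on[OF bounded_bilinear_vec_times])

lemma quad_scaleR: "quad y (c *\<^sub>R u) = c\<^sup>2 * quad y u"
  by (simp add: quad_def dirichlet_simps l2_simps power2_eq_square algebra_simps)

lemma open_Pos: "open Pos"
  unfolding Pos_def by (rule open_all_sphere[OF cont_quad quad_scaleR])

lemma open_Neg: "open Neg"
proof -
  have "continuous_on UNIV (\<lambda>(y, u). - quad y u)"
    using continuous_on_minus[OF cont_quad] by (simp add: case_prod_unfold)
  from open_all_sphere[OF this] show ?thesis unfolding Neg_def by (simp add: quad_scaleR)
qed

text \<open>The multiplication term is the sum of \<open>wt S i * y $ i * (u $ i)\<^sup>2\<close>,
  which increases with every entry of \<open>y\<close>.\<close>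

lemma Pos_mono:
  assumes "y \<in> Pos" "\<And>i. y $ i \<le> z $ i"
  shows "z \<in> Pos"
proof -
  have "quad y u \<le> quad z u" for u
  proof -
    have "L2 (y * u) u \<le> L2 (z * u) u"
      unfolding l2_def integ_def using assms(2) disc
      by (intro sum_mono) (auto simp: discretization_def less_imp_le mult.assoc intro!: mult_left_mono mult_right_mono)
    then show ?thesis by (simp add: quad_def)
  qed
  then show ?thesis using assms(1) by (fastforce simp: Pos_def intro: less_le_trans)
qed

lemma quad_Pos: "y \<in> Pos \<Longrightarrow> 0 \<le> quad y u"
  by (cases "u = 0") (auto simp: Pos_def less_imp_le quad_def linear_0[OF lin_dirichlet(1)])

lemma quad_Neg: "y \<in> Neg \<Longrightarrow> quad y u \<le> 0"
  by (cases "u = 0") (auto simp: Neg_def less_imp_le quad_def linear_0[OF lin_dirichlet(1)])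

lemma A_plus_eq: "A_plus S \<gamma> = Pos"
  by (simp add: A_plus_def op_less_def Pos_def quad_def matrix_vector_mult_add_rdistrib
      scaleR_matrix_vector_assoc[symmetric] l2_simps l2_neg_laplacian[OF disc])

text \<open>Subtracting \<open>K / 2\<close> from the shifted operator leaves the constant
  \<open>K / 2 + \<epsilon>\<close>, which is absorbed, halved, into the weight.\<close>

lemma B_star_iff: "v0 \<in> B_star S \<gamma> K \<epsilon> \<longleftrightarrow> v0 + vec ((K / 2 + \<epsilon>) / 2) \<in> Pos"
  by (simp add: B_star_def op_less_def Pos_def l2_shifted_op[OF disc] l2_simps quad_shift)
    (auto simp: quad_def algebra_simps)

text \<open>The potential is a quartic polynomial, so its second order remainder is exactly a form
  \<open>quad\<close> with a weight depending on both points. For \<open>u = p\<close> this weight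
  is the Hessian weight.\<close>

lemma pot_taylor:
  "pot c u = pot c p + L2 (grad_pot c p) (u - p)
    + 1 / 2 * quad (\<alpha> *\<^sub>R ((1/2) *\<^sub>R (3 *\<^sub>R (p * p) + 2 *\<^sub>R (p * u) + u * u) - vec \<beta>) + vec (c / 2)) (u - p)"
proof -
  define d where "d = u - p"
  have u: "u = p + d" by (simp add: d_def)
  have "\<alpha> / 2 * integ S ((u\<^sup>2 - vec \<beta>)\<^sup>2) = \<alpha> / 2 * integ S ((p\<^sup>2 - vec \<beta>)\<^sup>2)
     + L2 ((2 * \<alpha>) *\<^sub>R ((p * p - vec \<beta>) * p)) d
     + L2 ((\<alpha> *\<^sub>R ((1/2) *\<^sub>R (3 *\<^sub>R (p * p) + 2 *\<^sub>R (p * u) + u * u) - vec \<beta>)) * d) d"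
    unfolding l2_def integ_simps(3)[symmetric] integ_simps(1)[symmetric]
    by (rule arg_cong[of _ _ "integ S"]) (simp add: vec_eq_iff u power2_eq_square field_simps)
  moreover have "c / 2 * L2 u u = c / 2 * L2 p p + L2 (c *\<^sub>R p) d + c / 2 * L2 d d"
    by (simp add: u l2_simps l2_commute[of S d p] field_simps)
  moreover have "dirichlet S u u = dirichlet S p p + 2 * dirichlet S p d + dirichlet S d d"
    by (simp add: u dirichlet_simps dirichlet_commute[of S d p])
  ultimately show ?thesis
    unfolding pot_def d_def[symmetric] quad_shift
    by (simp add: grad_pot_def l2_simps l2_neg_laplacian[OF disc] quad_def field_simps)
qed

lemma pot_has_derivative: "(pot c has_derivative (\<lambda>h. L2 (grad_pot c u) h)) (at u)"
proof -
  note [derivative_intros] = bounded_bilinear.FDERIV[OF bounded_bilinear_dirichlet]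
    bounded_bilinear.FDERIV[OF bounded_bilinear_l2] bounded_bilinear.FDERIV[OF bounded_bilinear_vec_times]
  have eq: "pot c = (\<lambda>u. \<gamma> / 2 * dirichlet S u u + \<alpha> / 2 * L2 (u * u - vec \<beta>) (u * u - vec \<beta>) + c / 2 * L2 u u)"
    by (simp add: fun_eq_iff pot_def l2_def power2_eq_square)
  have *: "L2 (u * u - vec \<beta>) (u * h) = L2 ((u * u - vec \<beta>) * u) h"
     "L2 (u * u - vec \<beta>) (h * u) = L2 ((u * u - vec \<beta>) * u) h"
     "L2 (u * h) (u * u - vec \<beta>) = L2 ((u * u - vec \<beta>) * u) h"
     "L2 (h * u) (u * u - vec \<beta>) = L2 ((u * u - vec \<beta>) * u) h" for h
    by (simp_all add: l2_def mult_ac)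
  have **: "\<gamma> / 2 * (dirichlet S u h + dirichlet S h u)
      + \<alpha> / 2 * (L2 (u * u - vec \<beta>) (u * h + h * u) + L2 (u * h + h * u) (u * u - vec \<beta>))
      + c / 2 * (L2 u h + L2 h u) = L2 (grad_pot c u) h" for h
    unfolding dirichlet_commute[of S h u] l2_commute[of S h u] l2_simps(1,2) *
    by (simp add: l2_simps(1,2,5) * grad_pot_def l2_neg_laplacian[OF disc])
  show ?thesis
    unfolding eq **[symmetric]
    by (rule derivative_eq_intros refl)+ (simp add: fun_eq_iff)
qed

lemma grad_pot_has_derivative: "(grad_pot c has_derivative hess_pot c u) (at u)"
proof -
  note [derivative_intros] = bounded_bilinear.FDERIV[OF bounded_bilinear_vec_times]
    bounded_linear_imp_has_derivative[OF matrix_vector_mul_bounded_linear]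
  show ?thesis
    unfolding grad_pot_def
    by (rule derivative_eq_intros refl)+
      (simp add: fun_eq_iff hess_pot_def hess_weight_def vec_eq_iff algebra_simps)
qed

lemma cont_hess_weight: "continuous_on A (hess_weight c)"
  unfolding hess_weight_def
  by (intro continuous_intros bounded_bilinear.continuous_on[OF bounded_bilinear_vec_times])

lemma cont_hess_pot: "continuous_on A (\<lambda>u. hess_pot c u h)"
  unfolding hess_pot_def
  by (intro continuous_intros bounded_bilinear.continuous_on[OF bounded_bilinear_vec_times] cont_hess_weight)

lemma inj_hess_pot:
  assumes "hess_weight c u \<in> Pos \<union> Neg"
  shows "inj (hess_pot c u)"
proof -
  have lin: "linear (hess_pot c u)" using grad_pot_has_derivative has_derivative_linear by blast
  show ?thesis
  proof (rule linear_injective_0[OF lin, THEN iffD2], intro allI impI, rule ccontr)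
    fix h assume "hess_pot c u h = 0" "h \<noteq> 0"
    moreover then have "quad (hess_weight c u) h = 0" by (simp flip: L2_hess_pot_self)
    ultimately show False using assms by (auto simp: Pos_def Neg_def)
  qed
qed

text \<open>Definiteness of either sign makes the Hessian injective, so the gradient has a local
  inverse. It is continuous, and cutting its domain down to the preimage of \<open>W\<close> keeps
  its values in \<open>W\<close>.\<close>

lemma local_inverse_grad_pot:
  assumes "hess_weight c u0 \<in> Pos \<union> Neg" and W: "open W" "u0 \<in> W"
  obtains U G \<delta> where "open U" "u0 \<in> U" "U \<subseteq> W" "\<delta> > 0"
    "\<And>x. x \<in> U \<Longrightarrow> G (grad_pot c x) = x"
    "\<And>z. z \<in> ball (grad_pot c u0) \<delta> \<Longrightarrow> G z \<in> U"
    "\<And>z. z \<in> ball (grad_pot c u0) \<delta> \<Longrightarrow> grad_pot c (G z) = z"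
    "\<And>z. z \<in> ball (grad_pot c u0) \<delta> \<Longrightarrow>
      \<exists>D'. (G has_derivative D') (at z) \<and> (\<forall>h. hess_pot c (G z) (D' h) = h)"
proof -
  obtain U V G where *: "open U" "u0 \<in> U" "open V" "grad_pot c u0 \<in> V"
    "\<And>x. x \<in> U \<Longrightarrow> grad_pot c x \<in> V" "\<And>x. x \<in> U \<Longrightarrow> G (grad_pot c x) = x"
    "\<And>z. z \<in> V \<Longrightarrow> G z \<in> U" "\<And>z. z \<in> V \<Longrightarrow> grad_pot c (G z) = z"
    "\<And>z. z \<in> V \<Longrightarrow> \<exists>D'. (G has_derivative D') (at z) \<and> (\<forall>h. hess_pot c (G z) (D' h) = h)"
    using local_inverse[OF grad_pot_has_derivative cont_hess_pot inj_hess_pot[OF assms(1)]] by blast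
  have "continuous_on V G"
    using *(9) by (meson continuous_at_imp_continuous_on has_derivative_continuous)
  then have "open (V \<inter> G -` W)" using *(3) W(1) by (simp add: continuous_open_preimage)
  moreover have "grad_pot c u0 \<in> V \<inter> G -` W" using *(2,4,6) W(2) by simp
  ultimately obtain \<delta> where "\<delta> > 0" "ball (grad_pot c u0) \<delta> \<subseteq> V \<inter> G -` W"
    using open_contains_ball by blast
  then show thesis
    using * W by (intro that[of "U \<inter> W" \<delta> G]) (auto simp: subset_iff)
qed

text \<open>The derivative of \<open>z \<mapsto> - \<Phi>\<^sup>*(z)\<close>, the concave conjugate of the potential.\<close>

lemma value_has_derivative:
  assumes "(G has_derivative D') (at z)" "grad_pot c (G z) = z"
  shows "((\<lambda>z. pot c (G z) - L2 (G z) z) has_derivative (\<lambda>h. - L2 (G z) h)) (at z)"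
proof -
  have "((\<lambda>z. pot c (G z)) has_derivative (\<lambda>h. L2 (grad_pot c (G z)) (D' h))) (at z)"
    using has_derivative_compose[OF assms(1) pot_has_derivative] .
  \<comment> \<open>The two terms containing \<open>D'\<close> cancel because the gradient at
    \<open>G z\<close> is \<open>z\<close>: the envelope principle.\<close>
  from has_derivative_diff[OF this bounded_bilinear.FDERIV[OF bounded_bilinear_l2[of S] assms(1) has_derivative_ident]]
  show ?thesis by (simp add: assms(2) l2_commute[of S z])
qed

section \<open>Critical points of the energy and the admissible range of \<epsilon>\<close>

text \<open>As \<alpha> is positive, the Euler equation at node \<open>i\<close> can be solved for
  the cube of \<open>u $ i\<close>.\<close>

lemma finite_critical_points: "finite {u. grad_pot 0 u = f}"
proof (rule finite_cubic_system)
  fix u i assume "u \<in> {u. grad_pot 0 u = f}"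
  then have "grad_pot 0 u $ i = f $ i" by simp
  then have "\<gamma> * (\<Sum>j\<in>UNIV. neg_laplacian S $ i $ j * u $ j) + 2 * \<alpha> * (u $ i * u $ i - \<beta>) * u $ i = f $ i"
    by (simp add: grad_pot_def matrix_vector_mult_def algebra_simps)
  then have "u $ i ^ 3 = f $ i / (2 * \<alpha>) + (\<beta> * u $ i - \<gamma> / (2 * \<alpha>) * (\<Sum>j\<in>UNIV. neg_laplacian S $ i $ j * u $ j))"
    using \<alpha>_pos by (simp add: field_simps power3_eq_cube)
  also have "\<beta> * u $ i - \<gamma> / (2 * \<alpha>) * (\<Sum>j\<in>UNIV. neg_laplacian S $ i $ j * u $ j)
    = (\<Sum>j\<in>UNIV. ((if j = i then \<beta> else 0) - \<gamma> / (2 * \<alpha>) * neg_laplacian S $ i $ j) * u $ j)"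
    by (simp add: left_diff_distrib sum_subtractf sum_distrib_left if_distrib[of "\<lambda>x. x * _"] mult.assoc cong: if_cong)
  finally show "u $ i ^ 3 = f $ i / (2 * \<alpha>)
    + (\<Sum>j\<in>UNIV. ((if j = i then \<beta> else 0) - \<gamma> / (2 * \<alpha>) * neg_laplacian S $ i $ j) * u $ j)" .
qed

abbreviation v0_of :: "real^'n \<Rightarrow> real^'n" where "v0_of u \<equiv> \<alpha> *\<^sub>R (u\<^sup>2 - vec \<beta>)"

lemma energy_eq: "energy S \<alpha> \<beta> \<gamma> K f u = pot 0 u - L2 u f"
  by (simp add: energy_def energy_hat_def pot_def integ_def)

lemma energy_has_derivative:
  "(energy S \<alpha> \<beta> \<gamma> K f has_derivative (\<lambda>h. ((\<chi> i. wt S i) * (grad_pot 0 u - f)) \<bullet> h)) (at u)"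
  unfolding energy_eq l2_eq_inner[symmetric] l2_simps
  using has_derivative_diff[OF pot_has_derivative bounded_linear_imp_has_derivative[OF
      bounded_bilinear.bounded_linear_left[OF bounded_bilinear_l2]]]
  by (simp add: l2_commute[of S f])

lemma first_variation_zero_energy:
  assumes "first_variation_zero (energy S \<alpha> \<beta> \<gamma> K f) u"
  shows "grad_pot 0 u = f"
proof (rule ccontr)
  assume *: "grad_pot 0 u \<noteq> f"
  have "(\<lambda>h. ((\<chi> i. wt S i) * (grad_pot 0 u - f)) \<bullet> h) = (\<lambda>_. 0)"
    using has_derivative_unique[OF energy_has_derivative] assms unfolding first_variation_zero_def by blast
  then have "L2 (grad_pot 0 u - f) (grad_pot 0 u - f) = 0" by (simp add: l2_eq_inner fun_eq_iff)
  then show False using l2_nondegenerate[OF disc, of "grad_pot 0 u - f"] * by simp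
qed

text \<open>The gradient field in \<open>has_hessian\<close> is existential and prescribed only near
  \<open>u\<close>. Uniqueness of derivatives identifies it there with the explicit gradient, and
  then \<open>H\<close> with the derivative of the latter.\<close>

lemma energy_hessian:
  assumes "has_hessian (energy S \<alpha> \<beta> \<gamma> K f) H u"
  shows "H h \<bullet> h = quad (hess_weight 0 u) h"
proof -
  obtain g where g: "\<forall>\<^sub>F y in nhds u. (energy S \<alpha> \<beta> \<gamma> K f has_derivative (\<lambda>h. g y \<bullet> h)) (at y)"
    "(g has_derivative H) (at u)"
    using assms by (auto simp: has_hessian_def)
  define w where "w = (\<chi> i. wt S i)"
  have eq: "\<forall>\<^sub>F y in nhds u. g y = w * (grad_pot 0 y - f)"
    using g(1)
  proof eventually_elim
    case (elim y)
    have "(\<lambda>h. g y \<bullet> h) = (\<lambda>h. (w * (grad_pot 0 y - f)) \<bullet> h)"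
      unfolding w_def by (rule has_derivative_unique[OF elim energy_has_derivative])
    then show ?case by (metis vector_eq_rdot inner_commute)
  qed
  have "((\<lambda>y. w * (grad_pot 0 y - f)) has_derivative (\<lambda>h. w * hess_pot 0 u h)) (at u)"
    using bounded_linear.has_derivative[OF bounded_bilinear.bounded_linear_right[OF
        bounded_bilinear_vec_times, of w] has_derivative_diff[OF grad_pot_has_derivative has_derivative_const]]
    by simp
  moreover have "((\<lambda>y. w * (grad_pot 0 y - f)) has_derivative H) (at u)"
    by (rule has_derivative_transform_eventually[OF g(2)])
      (use eq eventually_nhds_x_imp_x[OF eq] in \<open>auto simp: eventually_at_filter elim: eventually_mono\<close>)
  ultimately have "H = (\<lambda>h. w * hess_pot 0 u h)" using has_derivative_unique by blast
  then show ?thesis by (simp add: w_def flip: l2_eq_inner L2_hess_pot_self)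
qed

lemma second_variation_pos_energy:
  "second_variation_pos (energy S \<alpha> \<beta> \<gamma> K f) u \<Longrightarrow> hess_weight 0 u \<in> Pos"
  by (auto simp: second_variation_pos_def Pos_def energy_hessian)

lemma second_variation_neg_energy:
  "second_variation_neg (energy S \<alpha> \<beta> \<gamma> K f) u \<Longrightarrow> hess_weight 0 u \<in> Neg"
  by (auto simp: second_variation_neg_def Neg_def energy_hessian)

lemma hess_weight_shift: "hess_weight c u = hess_weight 0 u + vec (c / 2)"
  by (simp add: hess_weight_def vec_eq_scaleR_one)

lemma hess_weight_Pos_mono: "hess_weight c u \<in> Pos \<Longrightarrow> c \<le> d \<Longrightarrow> hess_weight d u \<in> Pos"
  by (erule Pos_mono) (simp add: hess_weight_def)

text \<open>Each negative critical point tolerates small shifts since \<open>Neg\<close> is open;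
  finiteness of the critical set yields a common threshold.\<close>

lemma uniform_Neg_shift:
  obtains \<epsilon>0 where "\<epsilon>0 > 0"
    "\<And>u \<epsilon>. \<lbrakk>grad_pot 0 u = f; hess_weight 0 u \<in> Neg; \<epsilon> < \<epsilon>0; 0 < \<epsilon>\<rbrakk> \<Longrightarrow> hess_weight \<epsilon> u \<in> Neg"
proof -
  define Z where "Z = {u. grad_pot 0 u = f \<and> hess_weight 0 u \<in> Neg}"
  have "finite Z" unfolding Z_def by (rule finite_subset[OF _ finite_critical_points]) auto
  have "\<exists>e>0. \<forall>\<epsilon>. 0 < \<epsilon> \<and> \<epsilon> < e \<longrightarrow> hess_weight \<epsilon> u \<in> Neg" if "u \<in> Z" for u
  proof -
    have "continuous_on UNIV (\<lambda>\<epsilon>. hess_weight \<epsilon> u)"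
      unfolding hess_weight_def vec_eq_scaleR_one by (intro continuous_intros) auto
    then have "open ((\<lambda>\<epsilon>. hess_weight \<epsilon> u) -` Neg)" by (rule open_vimage[OF open_Neg])
    moreover have "0 \<in> (\<lambda>\<epsilon>. hess_weight \<epsilon> u) -` Neg" using that by (simp add: Z_def)
    ultimately obtain e where "e > 0" "ball 0 e \<subseteq> (\<lambda>\<epsilon>. hess_weight \<epsilon> u) -` Neg"
      using open_contains_ball by blast
    then show ?thesis by (intro exI[of _ e]) (auto simp: subset_iff dist_norm)
  qed
  then obtain e where e: "\<And>u. u \<in> Z \<Longrightarrow> e u > 0"
    "\<And>u \<epsilon>. \<lbrakk>u \<in> Z; 0 < \<epsilon>; \<epsilon> < e u\<rbrakk> \<Longrightarrow> hess_weight \<epsilon> u \<in> Neg"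
    by metis
  show thesis
  \<comment> \<open>The extra element \<open>1\<close> keeps the set nonempty when there is no
    critical point with negative Hessian.\<close>
  proof (rule that[of "Min (insert 1 (e ` Z))"])
    show "0 < Min (insert 1 (e ` Z))" using \<open>finite Z\<close> e(1) by simp
    show "hess_weight \<epsilon> u \<in> Neg" if "grad_pot 0 u = f" "hess_weight 0 u \<in> Neg"
      "\<epsilon> < Min (insert 1 (e ` Z))" "0 < \<epsilon>" for u \<epsilon>
      using that \<open>finite Z\<close> by (intro e(2)) (auto simp: Z_def)
  qed
qed

text \<open>The weight in \<open>pot_taylor\<close> tends to the Hessian weight as both arguments approach \<open>u0\<close>.\<close>

lemma taylor_neighbourhood:
  assumes "open P" "hess_weight c u0 \<in> P"
  obtains r where "r > 0" "\<And>p u. \<lbrakk>p \<in> ball u0 r; u \<in> ball u0 r\<rbrakk> \<Longrightarrow>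
    \<exists>y\<in>P. pot c u = pot c p + L2 (grad_pot c p) (u - p) + 1 / 2 * quad y (u - p)"
proof -
  define Y where "Y z = \<alpha> *\<^sub>R ((1/2) *\<^sub>R (3 *\<^sub>R (fst z * fst z) + 2 *\<^sub>R (fst z * snd z)
      + snd z * snd z) - vec \<beta>) + vec (c / 2)" for z :: "(real^'n) \<times> (real^'n)"
  have "continuous_on UNIV Y"
    unfolding Y_def by (intro continuous_intros bounded_bilinear.continuous_on[OF bounded_bilinear_vec_times])
  then have "open (Y -` P)" by (rule open_vimage[OF assms(1)])
  moreover have "Y (u0, u0) = hess_weight c u0" by (simp add: Y_def hess_weight_def vec_eq_iff)
  then have "(u0, u0) \<in> Y -` P" using assms(2) by simp
  ultimately obtain e where e: "e > 0" "ball (u0, u0) e \<subseteq> Y -` P"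
    using open_contains_ball by blast
  show thesis
  proof (rule that[of "e / 2"])
    show "e / 2 > 0" using e by simp
    fix p u assume "p \<in> ball u0 (e / 2)" "u \<in> ball u0 (e / 2)"
    then have "dist (u0, u0) (p, u) < e"
      unfolding dist_Pair_Pair using sqrt_sum_squares_le_sum[of "dist u0 p" "dist u0 u"] by simp
    then have "Y (p, u) \<in> P" using e(2) by auto
    then show "\<exists>y\<in>P. pot c u = pot c p + L2 (grad_pot c p) (u - p) + 1 / 2 * quad y (u - p)"
      by (rule bexI[rotated]) (simp add: Y_def pot_taylor[of c u p])
  qed
qed

end

section \<open>The dual functional and its majorant, by completing squares\<close>

locale dual_energy = discrete_energy \<Omega> S \<alpha> \<beta> \<gamma> f
  for \<Omega> :: "(real^3) set" and S :: "('n::finite, 'm::finite) scheme" and \<alpha> \<beta> \<gamma> :: real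
    and f :: "real^'n" +
  fixes K \<epsilon> :: real
  assumes K_pos: "K > 0" and \<epsilon>_pos: "\<epsilon> > 0"
begin

abbreviation J :: "real^'n \<Rightarrow> real" where "J \<equiv> energy S \<alpha> \<beta> \<gamma> K f"
abbreviation Js :: "real^'n \<Rightarrow> real^'n \<Rightarrow> real^'n \<Rightarrow> real" where "Js \<equiv> J_star S \<alpha> \<beta> \<gamma> K f \<epsilon>"
abbreviation B :: "(real^'n) set" where "B \<equiv> B_star S \<gamma> K \<epsilon>"
abbreviation M :: "real^'n \<Rightarrow> real^'n^'n" where "M \<equiv> shifted_op S \<gamma> K \<epsilon>"

text \<open>This is the majorant \<open>R\<close> of the overview; both penalties vanish for
  \<open>p = u\<close> and \<open>v = \<epsilon> *\<^sub>R u + f\<close>.\<close>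

definition primal :: "real^'n \<Rightarrow> real^'n \<Rightarrow> real^'n \<Rightarrow> real" where
  "primal v p u = J u + K / 2 * L2 (u - p) (u - p)
    + 1 / (2 * \<epsilon>) * L2 (v - f - \<epsilon> *\<^sub>R u) (v - f - \<epsilon> *\<^sub>R u)"

text \<open>Collecting the powers of \<open>u\<close> shows that stationarity in \<open>u\<close> is
  the equation \<open>grad_pot (K + \<epsilon>) u = v + K *\<^sub>R p\<close>.\<close>

lemma primal_eq:
  "primal v p u = pot (K + \<epsilon>) u - L2 u (v + K *\<^sub>R p)
    + (1 / (2 * \<epsilon>) * L2 (v - f) (v - f) + K / 2 * L2 p p)"
  using \<epsilon>_pos
  by (simp add: primal_def energy_eq pot_def l2_simps l2_commute[of S p u] l2_commute[of S f u]
      l2_commute[of S v u] l2_commute[of S f v] field_simps)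

lemma primal_diag: "primal v u u = pot \<epsilon> u - L2 u v + 1 / (2 * \<epsilon>) * L2 (v - f) (v - f)"
  by (simp add: primal_eq pot_def l2_simps field_simps)

lemma primal_ge_diag: "primal v u u \<le> primal v p u"
  using l2_pos[OF disc, of "u - p"] K_pos by (simp add: primal_def)

lemma energy_le_primal: "J u \<le> primal v p u"
  using l2_pos[OF disc] K_pos \<epsilon>_pos by (simp add: primal_def add.assoc)

lemma open_B: "open B"
proof -
  have "B = (\<lambda>v0. v0 + vec ((K / 2 + \<epsilon>) / 2)) -` Pos" by (auto simp: B_star_iff)
  then show ?thesis
    by (simp add: open_vimage[OF open_Pos] continuous_intros)
qed

text \<open>Entrywise the Hessian weight exceeds the weight in \<open>B_star_iff\<close> by
  \<open>2 * \<alpha> * (u $ i)\<^sup>2 + K / 4\<close>.\<close>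

lemma hess_weight_Pos:
  assumes "v0_of u \<in> B"
  shows "hess_weight (K + \<epsilon>) u \<in> Pos"
proof (rule Pos_mono[OF assms[unfolded B_star_iff]])
  fix i
  have "0 \<le> \<alpha> * (u $ i * u $ i)" using \<alpha>_pos by simp
  then show "(v0_of u + vec ((K / 2 + \<epsilon>) / 2)) $ i \<le> hess_weight (K + \<epsilon>) u $ i"
    using K_pos by (simp add: hess_weight_def power2_eq_square field_simps)
qed

lemma M_coercive: "v0 \<in> B \<Longrightarrow> K / 2 * L2 u u \<le> L2 (M v0 *v u) u"
  by (cases "u = 0") (auto simp: B_star_def op_less_def l2_simps less_imp_le)

lemma M_inverse:
  assumes "v0 \<in> B"
  shows "M v0 *v (matrix_inv (M v0) *v z) = z"
proof -
  have "inj ((*v) (M v0))"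
  proof (rule injI)
    fix x y assume "M v0 *v x = M v0 *v y"
    then have "M v0 *v (x - y) = 0" by (simp add: matrix_vector_mult_diff_distrib)
    then have "K / 2 * L2 (x - y) (x - y) \<le> 0" using M_coercive[OF assms, of "x - y"] by simp
    then have "\<not> 0 < L2 (x - y) (x - y)" using K_pos by (simp add: mult_le_0_iff)
    then show "x = y" using l2_nondegenerate[OF disc, of "x - y"] by auto
  qed
  then have "invertible (M v0)"
    using matrix_left_invertible_injective[of "M v0"] invertible_left_inverse[of "M v0"] by simp
  then have "M v0 ** matrix_inv (M v0) = mat 1"
    unfolding invertible_def matrix_inv_def by (rule someI2_ex) simp
  then show ?thesis by (simp add: matrix_vector_mul_assoc)
qed

lemma M_symmetric: "L2 (M v0 *v x) y = L2 (M v0 *v y) x"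
  by (simp add: l2_shifted_op[OF disc] dirichlet_commute[of S x y] l2_commute[of S x y]
      l2_mult_left[of S v0 x y] l2_commute[of S x "v0 * y"])

lemma M_inv_bounds:
  assumes "v0 \<in> B"
  shows "0 \<le> L2 (matrix_inv (M v0) *v r) r" "L2 (matrix_inv (M v0) *v r) r \<le> 2 / K * L2 r r"
proof -
  define x where "x = matrix_inv (M v0) *v r"
  have co: "K / 2 * L2 x x \<le> L2 x r"
    using M_coercive[OF assms, of x] M_inverse[OF assms, of r] by (simp add: x_def l2_commute)
  show "0 \<le> L2 (matrix_inv (M v0) *v r) r"
    using co K_pos l2_pos[OF disc, of x] unfolding x_def[symmetric]
    by (meson order_trans mult_nonneg_nonneg half_gt_zero less_imp_le)
  \<comment> \<open>With \<open>x\<close> the solution for right side \<open>r\<close>, expanding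
    this square and inserting the coercivity estimate \<open>co\<close> leaves
    \<open>K / 2 * L2 x r \<le> L2 r r\<close>, a bound uniform over \<open>B\<close>.\<close>
  have "0 \<le> L2 (r - (K / 2) *\<^sub>R x) (r - (K / 2) *\<^sub>R x)" by (rule l2_pos[OF disc])
  also have "\<dots> = L2 r r - K * L2 x r + K / 2 * (K / 2 * L2 x x)"
    by (simp add: l2_simps l2_commute[of S r x] field_simps)
  also have "\<dots> \<le> L2 r r - K * L2 x r + K / 2 * L2 x r"
    using co K_pos by (intro add_left_mono mult_left_mono) auto
  finally show "L2 (matrix_inv (M v0) *v r) r \<le> 2 / K * L2 r r"
    using K_pos by (simp add: x_def field_simps)
qed

text \<open>The point \<open>u\<close> is free. It will be \<open>u0\<close> for the first
  variation, a solution of the Euler equation for the supremum over \<open>v0\<close>, and the point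
  with zero residual for the global lower bound.\<close>

lemma J_star_decomp:
  assumes "v0 \<in> B"
  defines "r \<equiv> \<lambda>v p u. v + K *\<^sub>R p - M v0 *v u"
  shows "Js v v0 p = primal v p u - 1 / (2 * \<alpha>) * L2 (v0 - v0_of u) (v0 - v0_of u)
    - 1 / 2 * L2 (matrix_inv (M v0) *v r v p u) (r v p u)"
proof -
  define N where "N = matrix_inv (M v0)"
  define z where "z = v + K *\<^sub>R p"
  have NM: "N *v (M v0 *v u) = u"
  proof -
    have "M v0 *v (N *v (M v0 *v u) - u) = 0"
      using M_inverse[OF assms(1)] by (simp add: N_def matrix_vector_mult_diff_distrib)
    then have "K / 2 * L2 (N *v (M v0 *v u) - u) (N *v (M v0 *v u) - u) \<le> 0"
      using M_coercive[OF assms(1), of "N *v (M v0 *v u) - u"] by simp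
    then have "\<not> 0 < L2 (N *v (M v0 *v u) - u) (N *v (M v0 *v u) - u)"
      using K_pos by (simp add: mult_le_0_iff)
    then show ?thesis using l2_nondegenerate[OF disc, of "N *v (M v0 *v u) - u"] by auto
  qed
  have cross: "L2 (N *v z) (M v0 *v u) = L2 u z"
    using M_symmetric[of v0 u "N *v z"] M_inverse[OF assms(1), of z]
    by (simp add: N_def l2_commute)
  have r: "L2 (N *v r v p u) (r v p u) = L2 (N *v z) z - 2 * L2 u z + L2 (M v0 *v u) u"
    by (simp add: r_def z_def[symmetric] matrix_vector_mult_diff_distrib NM l2_simps cross
        l2_commute[of S u "M v0 *v u"])
  have sq: "integ S (x\<^sup>2) = L2 x x" for x :: "real^'n" by (simp add: l2_def power2_eq_square)
  \<comment> \<open>Completing the square in \<open>v0\<close>, an identity that holds at each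
    node.\<close>
  have key: "L2 (v0 * u) u - 1 / (2 * \<alpha>) * integ S (v0\<^sup>2) - \<beta> * integ S v0
      = \<alpha> / 2 * integ S ((u\<^sup>2 - vec \<beta>)\<^sup>2) - 1 / (2 * \<alpha>) * L2 (v0 - v0_of u) (v0 - v0_of u)"
    unfolding l2_def integ_simps(3)[symmetric] integ_simps(2)[symmetric]
    by (rule arg_cong[of _ _ "integ S"])
      (use \<alpha>_pos in \<open>simp add: vec_eq_iff power2_eq_square field_simps\<close>)
  show ?thesis
    unfolding J_star_def G_star_eq[OF disc \<alpha>_pos K_pos assms(1)] F_star_eq[OF disc \<epsilon>_pos] H_fun_def
      N_def[symmetric] r z_def[symmetric] primal_eq pot_def sq[of p] sq[of "v - f"] l2_shifted_op[OF disc]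
    using key by (simp add: field_simps)
qed

lemma J_star_le_primal:
  assumes "v0 \<in> B"
  shows "Js v v0 p \<le> primal v p u"
proof -
  have "0 \<le> 1 / (2 * \<alpha>) * L2 (v0 - v0_of u) (v0 - v0_of u)" using \<alpha>_pos l2_pos[OF disc] by simp
  then show ?thesis
    using M_inv_bounds(1)[OF assms, of "v + K *\<^sub>R p - M v0 *v u"]
    unfolding J_star_decomp[OF assms, of v p u] by linarith
qed

lemma M_v0_of: "M (v0_of u) *v u = grad_pot (K + \<epsilon>) u"
  by (simp add: shifted_op_def grad_pot_def matrix_vector_mult_add_rdistrib
      scaleR_matrix_vector_assoc[symmetric] power2_eq_square scaleR_add_left)

lemma J_star_eq_primal:
  assumes "v0_of u \<in> B" "grad_pot (K + \<epsilon>) u = v + K *\<^sub>R p"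
  shows "Js v (v0_of u) p = primal v p u"
  unfolding J_star_decomp[OF assms(1), of v p u] M_v0_of by (simp add: assms(2))

text \<open>The majorant is attained at \<open>v0_of u\<close>. The set \<open>C\<close> will be
  \<open>B\<close> in the local statements and \<open>Pos \<inter> B\<close> in the global
  one.\<close>

lemma SUP_J_star:
  assumes "C \<subseteq> B" "v0_of u \<in> C" "grad_pot (K + \<epsilon>) u = v + K *\<^sub>R p"
  shows "(SUP v0\<in>C. ereal (Js v v0 p)) = ereal (primal v p u)"
proof (rule antisym)
  show "(SUP v0\<in>C. ereal (Js v v0 p)) \<le> ereal (primal v p u)"
    using assms J_star_le_primal by (intro SUP_least) auto
  show "ereal (primal v p u) \<le> (SUP v0\<in>C. ereal (Js v v0 p))"
    using assms J_star_eq_primal[of u v p] by (intro SUP_upper2[of "v0_of u"]) auto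
qed

lemma critical_J_star:
  assumes crit: "grad_pot 0 u0 = f" and u0: "v0_of u0 \<in> B"
  shows "first_variation_zero (\<lambda>(v, v0, p). Js v v0 p) (\<epsilon> *\<^sub>R u0 + f, v0_of u0, u0)"
    and "Js (\<epsilon> *\<^sub>R u0 + f) (v0_of u0) u0 = J u0"
proof -
  define r where "r v v0 p = v + K *\<^sub>R p - M v0 *v u0" for v v0 p
  \<comment> \<open>By the Euler equation for \<open>u0\<close> the residual is linear in the
    displacement from the critical triple.\<close>
  have r: "r v v0 p = (v - (\<epsilon> *\<^sub>R u0 + f)) + K *\<^sub>R (p - u0) - 2 *\<^sub>R ((v0 - v0_of u0) * u0)" for v v0 p
  proof -
    have "M v0 *v u0 = M (v0_of u0) *v u0 + 2 *\<^sub>R ((v0 - v0_of u0) * u0)"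
      by (simp add: shifted_op_def matrix_vector_mult_add_rdistrib
          scaleR_matrix_vector_assoc[symmetric] algebra_simps)
    also have "M (v0_of u0) *v u0 = f + (K + \<epsilon>) *\<^sub>R u0"
      unfolding M_v0_of grad_pot_shift[of "K + \<epsilon>"] crit by simp
    finally show ?thesis by (simp add: r_def algebra_simps)
  qed
  \<comment> \<open>The corrections in \<open>J_star_decomp\<close> taken with positive sign, the
    inverse matrix being replaced by its bound \<open>2 / K\<close>: all terms are squares of the
    displacement.\<close>
  define Q where "Q = (\<lambda>(v, v0, p). K / 2 * L2 (u0 - p) (u0 - p)
    + 1 / (2 * \<epsilon>) * L2 (v - f - \<epsilon> *\<^sub>R u0) (v - f - \<epsilon> *\<^sub>R u0)
    + 1 / (2 * \<alpha>) * L2 (v0 - v0_of u0) (v0 - v0_of u0)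
    + 1 / K * L2 (r v v0 p) (r v v0 p))"
  show eq: "Js (\<epsilon> *\<^sub>R u0 + f) (v0_of u0) u0 = J u0"
    unfolding J_star_decomp[OF u0, of _ u0 u0] r_def[symmetric] r by (simp add: primal_def)
  have bound: "\<bar>Js v v0 p - J u0\<bar> \<le> Q (v, v0, p)" if "v0 \<in> B" for v v0 p
  proof -
    have "0 \<le> L2 (matrix_inv (M v0) *v r v v0 p) (r v v0 p)"
      "L2 (matrix_inv (M v0) *v r v v0 p) (r v v0 p) \<le> 2 * (1 / K * L2 (r v v0 p) (r v v0 p))"
      using M_inv_bounds[OF that, of "r v v0 p"] by simp_all
    moreover have "0 \<le> K / 2 * L2 (u0 - p) (u0 - p)"
      "0 \<le> 1 / (2 * \<epsilon>) * L2 (v - f - \<epsilon> *\<^sub>R u0) (v - f - \<epsilon> *\<^sub>R u0)"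
      "0 \<le> 1 / (2 * \<alpha>) * L2 (v0 - v0_of u0) (v0 - v0_of u0)"
      using l2_pos[OF disc] K_pos \<epsilon>_pos \<alpha>_pos by simp_all
    ultimately show ?thesis
      unfolding J_star_decomp[OF that, of v p u0] r_def[symmetric] primal_def Q_def prod.case
      by linarith
  qed
  define x where "x = (\<epsilon> *\<^sub>R u0 + f, v0_of u0, u0)"
  have "((\<lambda>(v, v0, p). Js v v0 p) has_derivative (\<lambda>_. 0)) (at x)"
  proof (rule has_derivative_zero_dominated[of "UNIV \<times> B \<times> UNIV" _ _ Q])
    show "open (UNIV \<times> B \<times> UNIV)" by (intro open_Times open_B open_UNIV)
    show "x \<in> UNIV \<times> B \<times> UNIV" using u0 by (simp add: x_def)
    show "\<bar>(case y of (v, v0, p) \<Rightarrow> Js v v0 p) - (case x of (v, v0, p) \<Rightarrow> Js v v0 p)\<bar> \<le> Q y"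
      if "y \<in> UNIV \<times> B \<times> UNIV" for y
      using that bound eq by (auto simp: x_def)
    show "Q x = 0" by (simp add: Q_def x_def r)
    note [derivative_intros] = bounded_bilinear.FDERIV[OF bounded_bilinear_l2]
      bounded_bilinear.FDERIV[OF bounded_bilinear_vec_times]
    show "(Q has_derivative (\<lambda>_. 0)) (at x)"
      unfolding Q_def case_prod_unfold r
      by (rule derivative_eq_intros refl)+ (simp add: x_def fun_eq_iff)
  qed
  then show "first_variation_zero (\<lambda>(v, v0, p). Js v v0 p) (\<epsilon> *\<^sub>R u0 + f, v0_of u0, u0)"
    by (simp add: first_variation_zero_def x_def)
qed

section \<open>Variations of the reduced dual function and the nested local inverses\<close>

text \<open>
  \<open>\<psi>\<close> inverts the gradient of \<open>pot \<epsilon>\<close>, so \<open>primal v (\<psi> v) (\<psi> v)\<close> is the stationary value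
  of \<open>u \<mapsto> primal v u u\<close>: up to the term quadratic in \<open>v\<close> it is minus a conjugate function, with Hessian
  \<open>1 / \<epsilon> - (\<delta>\<^sup>2 J + \<epsilon>)\<inverse>\<close>.
\<close>

lemma reduced_dual_variations:
  assumes crit: "grad_pot 0 u0 = f" and "\<delta> > 0"
    and \<psi>0: "\<psi> (\<epsilon> *\<^sub>R u0 + f) = u0"
    and \<psi>: "\<And>v. v \<in> ball (\<epsilon> *\<^sub>R u0 + f) \<delta> \<Longrightarrow> grad_pot \<epsilon> (\<psi> v) = v"
      "\<And>v. v \<in> ball (\<epsilon> *\<^sub>R u0 + f) \<delta> \<Longrightarrow>
        \<exists>D'. (\<psi> has_derivative D') (at v) \<and> (\<forall>h. hess_pot \<epsilon> (\<psi> v) (D' h) = h)"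
    and sign: "hess_weight 0 u0 \<in> Pos \<or> hess_weight \<epsilon> u0 \<in> Neg"
  shows "first_variation_zero (\<lambda>v. primal v (\<psi> v) (\<psi> v)) (\<epsilon> *\<^sub>R u0 + f)"
    and "second_variation_pos (\<lambda>v. primal v (\<psi> v) (\<psi> v)) (\<epsilon> *\<^sub>R u0 + f)"
proof -
  define w where "w = (\<chi> i. wt S i)"
  define vh where "vh = \<epsilon> *\<^sub>R u0 + f"
  define g where "g v = w * ((1 / \<epsilon>) *\<^sub>R (v - f) - \<psi> v)" for v
  have der: "((\<lambda>v. primal v (\<psi> v) (\<psi> v)) has_derivative (\<lambda>h. g v \<bullet> h)) (at v)"
    if v: "v \<in> ball vh \<delta>" for v
  proof -
    obtain D' where D': "(\<psi> has_derivative D') (at v)" using \<psi>(2) v unfolding vh_def by blast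
    note d1 = value_has_derivative[OF D' \<psi>(1)[OF v[unfolded vh_def]]]
    have "((\<lambda>v. v - f) has_derivative (\<lambda>h. h)) (at v)" by (auto intro!: derivative_eq_intros)
    from has_derivative_add[OF d1 has_derivative_mult_right[OF
        bounded_bilinear.FDERIV[OF bounded_bilinear_l2[of S] this this], of "1 / (2 * \<epsilon>)"]]
    have "((\<lambda>v. primal v (\<psi> v) (\<psi> v)) has_derivative
        (\<lambda>h. - L2 (\<psi> v) h + 1 / (2 * \<epsilon>) * (L2 (v - f) h + L2 h (v - f)))) (at v)"
      unfolding primal_diag .
    moreover have "- L2 (\<psi> v) h + 1 / (2 * \<epsilon>) * (L2 (v - f) h + L2 h (v - f)) = g v \<bullet> h" for h
      unfolding g_def w_def l2_eq_inner[symmetric] l2_commute[of S h "v - f"]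
      using \<epsilon>_pos by (simp add: l2_simps field_simps)
    ultimately show ?thesis by simp
  qed
  have vh: "vh \<in> ball vh \<delta>" using \<open>\<delta> > 0\<close> by simp
  have "g vh = 0" using \<epsilon>_pos by (simp add: g_def vh_def \<psi>0)
  then show "first_variation_zero (\<lambda>v. primal v (\<psi> v) (\<psi> v)) (\<epsilon> *\<^sub>R u0 + f)"
    using der[OF vh] by (simp add: first_variation_zero_def vh_def)
  obtain D' where D': "(\<psi> has_derivative D') (at vh)" "\<And>h. hess_pot \<epsilon> u0 (D' h) = h"
    using \<psi>(2)[OF vh[unfolded vh_def]] \<psi>0 unfolding vh_def by metis
  have g: "(g has_derivative (\<lambda>h. w * ((1 / \<epsilon>) *\<^sub>R h - D' h))) (at vh)"
    unfolding g_def
    by (rule bounded_linear.has_derivative[OF bounded_bilinear.bounded_linear_right[OF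
        bounded_bilinear_vec_times]]) (auto intro!: derivative_eq_intros D')
  have "\<forall>\<^sub>F y in nhds vh. ((\<lambda>v. primal v (\<psi> v) (\<psi> v)) has_derivative (\<lambda>h. g y \<bullet> h)) (at y)"
    using eventually_nhds_in_open[OF open_ball vh] by eventually_elim (rule der)
  then have hess: "has_hessian (\<lambda>v. primal v (\<psi> v) (\<psi> v)) (\<lambda>h. w * ((1 / \<epsilon>) *\<^sub>R h - D' h)) vh"
    using g by (auto simp: has_hessian_def)
  have "0 < (w * ((1 / \<epsilon>) *\<^sub>R h - D' h)) \<bullet> h" if "h \<noteq> 0" for h
  proof -
    \<comment> \<open>Substituting \<open>h = hess_pot \<epsilon> u0 k\<close> removes the inverse
      Hessian from the quadratic form.\<close>
    define k where "k = D' h"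
    have h: "h = hess_pot \<epsilon> u0 k" by (simp add: k_def D'(2))
    have "linear (hess_pot \<epsilon> u0)" using grad_pot_has_derivative has_derivative_linear by blast
    then have "k \<noteq> 0" using that h linear_0 by blast
    have eq: "(w * ((1 / \<epsilon>) *\<^sub>R h - D' h)) \<bullet> h = 1 / \<epsilon> * L2 h h - L2 k h"
      by (simp add: w_def k_def l2_simps flip: l2_eq_inner)
    from sign show ?thesis
    proof
      assume neg: "hess_weight \<epsilon> u0 \<in> Neg"
      have "L2 k h < 0"
        using neg \<open>k \<noteq> 0\<close> by (simp add: h l2_commute[of S k] L2_hess_pot_self Neg_def)
      moreover have "0 \<le> 1 / \<epsilon> * L2 h h" using \<epsilon>_pos l2_pos[OF disc] by simp
      ultimately show ?thesis unfolding eq by linarith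
    next
      assume pos: "hess_weight 0 u0 \<in> Pos"
      \<comment> \<open>In terms of \<open>m\<close> the form is
        \<open>1 / \<epsilon> * L2 m m + L2 m k\<close>, whose second term is the Hessian of the
        energy at \<open>k\<close>.\<close>
      define m where "m = hess_pot 0 u0 k"
      have hm: "h = m + \<epsilon> *\<^sub>R k" by (simp add: h m_def hess_pot_shift[of \<epsilon>])
      have "0 < L2 m k" using pos \<open>k \<noteq> 0\<close> by (simp add: m_def L2_hess_pot_self Pos_def)
      moreover have "0 \<le> 1 / \<epsilon> * L2 m m" using \<epsilon>_pos l2_pos[OF disc] by simp
      moreover have "1 / \<epsilon> * L2 h h - L2 k h = 1 / \<epsilon> * L2 m m + L2 m k"
        using \<epsilon>_pos by (simp add: hm l2_simps l2_commute[of S k m] field_simps)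
      ultimately show ?thesis unfolding eq by linarith
    qed
  qed
  then show "second_variation_pos (\<lambda>v. primal v (\<psi> v) (\<psi> v)) (\<epsilon> *\<^sub>R u0 + f)"
    using hess unfolding second_variation_pos_def vh_def by blast
qed

lemma ball_shift:
  fixes v v1 p p1 :: "real^'n"
  assumes "v \<in> ball v1 (\<delta> / 2)" "p \<in> ball p1 (\<delta> / (2 * K))"
  shows "v + K *\<^sub>R p \<in> ball (v1 + K *\<^sub>R p1) \<delta>"
proof -
  have "norm (p1 - p) < \<delta> / (2 * K)" using assms(2) by (simp add: dist_norm)
  then have "norm (K *\<^sub>R (p1 - p)) < \<delta> / 2"
    unfolding norm_scaleR using K_pos by (simp add: field_simps)
  moreover have "norm (v1 - v) < \<delta> / 2" using assms(1) by (simp add: dist_norm)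
  moreover have "norm ((v1 + K *\<^sub>R p1) - (v + K *\<^sub>R p)) \<le> norm (v1 - v) + norm (K *\<^sub>R (p1 - p))"
    using norm_triangle_ineq[of "v1 - v" "K *\<^sub>R (p1 - p)"] by (simp add: algebra_simps)
  ultimately show ?thesis by (simp add: dist_norm)
qed

lemma grad_pot_critical:
  assumes "grad_pot 0 u0 = f"
  shows "grad_pot \<epsilon> u0 = \<epsilon> *\<^sub>R u0 + f" "grad_pot (K + \<epsilon>) u0 = (\<epsilon> *\<^sub>R u0 + f) + K *\<^sub>R u0"
  using grad_pot_shift[of \<epsilon> u0] grad_pot_shift[of "K + \<epsilon>" u0] assms by (simp_all add: algebra_simps)

lemma primal_critical: "primal (\<epsilon> *\<^sub>R u0 + f) u0 u0 = J u0"
  by (simp add: primal_def)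

text \<open>
  The two local inverses \<open>\<phi>\<close> and \<open>\<psi>\<close> are related by \<open>\<phi> (v + K *\<^sub>R \<psi> v) = \<psi> v\<close>, since
  the gradients of \<open>pot (K + \<epsilon>)\<close> and \<open>pot \<epsilon>\<close> differ by \<open>K\<close> times the identity.
\<close>

lemma local_dual_setup:
  assumes crit: "grad_pot 0 u0 = f" and u0: "v0_of u0 \<in> B"
    and \<epsilon>w: "hess_weight \<epsilon> u0 \<in> Pos \<union> Neg" and "r > 0"
  obtains r2 r3 \<phi> \<psi> where "r2 > 0" "r2 \<le> r" "r3 > 0"
    "\<psi> (\<epsilon> *\<^sub>R u0 + f) = u0"
    "\<And>v. v \<in> ball (\<epsilon> *\<^sub>R u0 + f) r3 \<Longrightarrow> \<psi> v \<in> ball u0 r2"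
    "\<And>v. v \<in> ball (\<epsilon> *\<^sub>R u0 + f) r3 \<Longrightarrow> grad_pot \<epsilon> (\<psi> v) = v"
    "\<And>v. v \<in> ball (\<epsilon> *\<^sub>R u0 + f) r3 \<Longrightarrow>
      \<exists>D'. (\<psi> has_derivative D') (at v) \<and> (\<forall>h. hess_pot \<epsilon> (\<psi> v) (D' h) = h)"
    "\<And>v p. \<lbrakk>v \<in> ball (\<epsilon> *\<^sub>R u0 + f) r3; p \<in> ball u0 r2\<rbrakk> \<Longrightarrow> \<phi> (v + K *\<^sub>R p) \<in> ball u0 r"
    "\<And>v p. \<lbrakk>v \<in> ball (\<epsilon> *\<^sub>R u0 + f) r3; p \<in> ball u0 r2\<rbrakk> \<Longrightarrow>
      (SUP v0\<in>B. ereal (Js v v0 p)) = ereal (primal v p (\<phi> (v + K *\<^sub>R p)))"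
    "\<And>v. v \<in> ball (\<epsilon> *\<^sub>R u0 + f) r3 \<Longrightarrow> \<phi> (v + K *\<^sub>R \<psi> v) = \<psi> v"
proof -
  define vh where "vh = \<epsilon> *\<^sub>R u0 + f"
  note gc = grad_pot_critical[OF crit, folded vh_def]
  have "continuous_on UNIV v0_of"
    unfolding power2_eq_square
    by (intro continuous_intros bounded_bilinear.continuous_on[OF bounded_bilinear_vec_times])
  then have "open (v0_of -` B)" by (rule open_vimage[OF open_B])
  then have W: "open (ball u0 r \<inter> v0_of -` B)" "u0 \<in> ball u0 r \<inter> v0_of -` B"
    using u0 \<open>r > 0\<close> by auto
  obtain U1 \<phi> \<delta>1 where U1: "open U1" "u0 \<in> U1" "U1 \<subseteq> ball u0 r \<inter> v0_of -` B" "\<delta>1 > 0"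
    "\<And>x. x \<in> U1 \<Longrightarrow> \<phi> (grad_pot (K + \<epsilon>) x) = x"
    "\<And>z. z \<in> ball (vh + K *\<^sub>R u0) \<delta>1 \<Longrightarrow> \<phi> z \<in> U1"
    "\<And>z. z \<in> ball (vh + K *\<^sub>R u0) \<delta>1 \<Longrightarrow> grad_pot (K + \<epsilon>) (\<phi> z) = z"
    by (rule local_inverse_grad_pot[OF UnI1[OF hess_weight_Pos[OF u0]] W, unfolded gc]) blast
  \<comment> \<open>Together with \<open>r3 \<le> \<delta>1 / 2\<close>, the bound
    \<open>\<delta>1 / (2 * K)\<close> keeps \<open>v + K *\<^sub>R p\<close> in the domain of
    \<open>\<phi>\<close>.\<close>
  define r2 where "r2 = min r (\<delta>1 / (2 * K))"
  have r2: "r2 > 0" "r2 \<le> r" "r2 \<le> \<delta>1 / (2 * K)" using \<open>r > 0\<close> \<open>\<delta>1 > 0\<close> K_pos by (auto simp: r2_def)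
  \<comment> \<open>Intersecting with \<open>U1\<close> places the values of \<open>\<psi>\<close>
    where \<open>\<phi>\<close> inverts the larger gradient, which gives the relation between the
    two inverses.\<close>
  have W2: "open (ball u0 r2 \<inter> U1)" "u0 \<in> ball u0 r2 \<inter> U1" using U1(1,2) r2(1) by auto
  obtain U2 \<psi> \<delta>2 where U2: "open U2" "u0 \<in> U2" "U2 \<subseteq> ball u0 r2 \<inter> U1" "\<delta>2 > 0"
    "\<And>x. x \<in> U2 \<Longrightarrow> \<psi> (grad_pot \<epsilon> x) = x"
    "\<And>z. z \<in> ball vh \<delta>2 \<Longrightarrow> \<psi> z \<in> U2"
    "\<And>z. z \<in> ball vh \<delta>2 \<Longrightarrow> grad_pot \<epsilon> (\<psi> z) = z"
    "\<And>z. z \<in> ball vh \<delta>2 \<Longrightarrow>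
      \<exists>D'. (\<psi> has_derivative D') (at z) \<and> (\<forall>h. hess_pot \<epsilon> (\<psi> z) (D' h) = h)"
    by (rule local_inverse_grad_pot[OF \<epsilon>w W2, unfolded gc]) blast
  define r3 where "r3 = min (\<delta>1 / 2) \<delta>2"
  have r3: "r3 > 0" "r3 \<le> \<delta>1 / 2" "r3 \<le> \<delta>2" using U1(4) U2(4) by (auto simp: r3_def)
  have \<delta>2: "v \<in> ball vh \<delta>2" if "v \<in> ball vh r3" for v using that r3(3) by auto
  have z: "v + K *\<^sub>R p \<in> ball (vh + K *\<^sub>R u0) \<delta>1" if "v \<in> ball vh r3" "p \<in> ball u0 r2" for v p
    by (rule ball_shift) (use that r2(3) r3(2) in auto)
  show thesis
  proof (rule that[of r2 r3 \<psi> \<phi>, folded vh_def])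
    show "\<psi> vh = u0" using U2(5)[OF U2(2)] gc by simp
    show "\<psi> v \<in> ball u0 r2" if "v \<in> ball vh r3" for v using U2(3) U2(6)[OF \<delta>2[OF that]] by blast
    show "\<phi> (v + K *\<^sub>R p) \<in> ball u0 r" if "v \<in> ball vh r3" "p \<in> ball u0 r2" for v p
      using U1(3) U1(6)[OF z[OF that]] by blast
    show "(SUP v0\<in>B. ereal (Js v v0 p)) = ereal (primal v p (\<phi> (v + K *\<^sub>R p)))"
      if "v \<in> ball vh r3" "p \<in> ball u0 r2" for v p
      using U1(3) U1(6)[OF z[OF that]] U1(7)[OF z[OF that]] by (intro SUP_J_star) auto
    show "\<phi> (v + K *\<^sub>R \<psi> v) = \<psi> v" if v: "v \<in> ball vh r3" for v
    proof -
      have "grad_pot (K + \<epsilon>) (\<psi> v) = v + K *\<^sub>R \<psi> v"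
        using U2(7)[OF \<delta>2[OF v]] grad_pot_shift[of "K + \<epsilon>" "\<psi> v"] grad_pot_shift[of \<epsilon> "\<psi> v"]
        by (simp add: algebra_simps)
      then show ?thesis using U1(5)[of "\<psi> v"] U2(3) U2(6)[OF \<delta>2[OF v]] by auto
    qed
  qed (use r2 r3 U2(7,8) \<delta>2 in auto)
qed

section \<open>Local duality at minima and maxima\<close>

lemma pot_energy_step:
  assumes "grad_pot 0 u0 = f" "pot 0 u = pot 0 u0 + L2 (grad_pot 0 u0) (u - u0) + 1 / 2 * q"
  shows "J u = J u0 + 1 / 2 * q"
  using assms by (simp add: energy_eq l2_simps l2_commute[of S f])

text \<open>Here \<open>p\<close> is stationary for \<open>u \<mapsto> primal v u u\<close>, so the
  linear term of the Taylor formula cancels.\<close>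

lemma pot_primal_step:
  assumes "grad_pot \<epsilon> p = v" "pot \<epsilon> u = pot \<epsilon> p + L2 (grad_pot \<epsilon> p) (u - p) + 1 / 2 * q"
  shows "primal v u u = primal v p p + 1 / 2 * q"
  using assms by (simp add: primal_diag l2_simps l2_commute[of S v u] l2_commute[of S v p])

text \<open>For given \<open>p\<close> let \<open>u\<close> solve the Euler equation. Then
  \<open>primal v p u\<close> is at least its diagonal value at \<open>u\<close>, which by local
  convexity of \<open>pot \<epsilon>\<close> is at least the one at \<open>\<psi> v\<close>;
  equality occurs for \<open>p = \<psi> v\<close>. The outer infimum follows from
  \<open>J u0 \<le> J (\<psi> v) \<le> J3 v\<close>.\<close>

lemma duality_local_min:
  assumes crit: "grad_pot 0 u0 = f" and u0: "v0_of u0 \<in> B" and pos: "hess_weight 0 u0 \<in> Pos"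
  shows "\<exists>r1>0. \<exists>r2>0. \<exists>r3>0.
    ereal (J u0) = (INF u\<in>ball u0 r1. ereal (J u)) \<and>
    ereal (J u0) = (INF v\<in>ball (\<epsilon> *\<^sub>R u0 + f) r3. INF p\<in>ball u0 r2. SUP v0\<in>B. ereal (Js v v0 p)) \<and>
    J u0 = Js (\<epsilon> *\<^sub>R u0 + f) (v0_of u0) u0 \<and>
    (\<exists>J3. (\<forall>v\<in>ball (\<epsilon> *\<^sub>R u0 + f) r3. ereal (J3 v) = (INF p\<in>ball u0 r2. SUP v0\<in>B. ereal (Js v v0 p))) \<and>
      first_variation_zero J3 (\<epsilon> *\<^sub>R u0 + f) \<and> second_variation_pos J3 (\<epsilon> *\<^sub>R u0 + f) \<and>
      ereal (J u0) = (INF v\<in>ball (\<epsilon> *\<^sub>R u0 + f) r3. ereal (J3 v)) \<and>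
      J u0 = J3 (\<epsilon> *\<^sub>R u0 + f))"
proof -
  define vh where "vh = \<epsilon> *\<^sub>R u0 + f"
  have pos\<epsilon>: "hess_weight \<epsilon> u0 \<in> Pos"
    using hess_weight_Pos_mono[OF pos] \<epsilon>_pos by simp
  obtain ra where ra: "ra > 0" "\<And>p u. \<lbrakk>p \<in> ball u0 ra; u \<in> ball u0 ra\<rbrakk> \<Longrightarrow>
    \<exists>y\<in>Pos. pot 0 u = pot 0 p + L2 (grad_pot 0 p) (u - p) + 1 / 2 * quad y (u - p)"
    using taylor_neighbourhood[OF open_Pos pos] by blast
  obtain rb where rb: "rb > 0" "\<And>p u. \<lbrakk>p \<in> ball u0 rb; u \<in> ball u0 rb\<rbrakk> \<Longrightarrow>
    \<exists>y\<in>Pos. pot \<epsilon> u = pot \<epsilon> p + L2 (grad_pot \<epsilon> p) (u - p) + 1 / 2 * quad y (u - p)"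
    using taylor_neighbourhood[OF open_Pos pos\<epsilon>] by blast
  have J_min: "J u0 \<le> J u" if u: "u \<in> ball u0 ra" for u
  proof -
    obtain y where y: "y \<in> Pos" "pot 0 u = pot 0 u0 + L2 (grad_pot 0 u0) (u - u0) + 1 / 2 * quad y (u - u0)"
      using ra(2)[of u0 u] ra(1) u by auto
    show ?thesis using pot_energy_step[OF crit y(2)] quad_Pos[OF y(1), of "u - u0"] by simp
  qed
  define r where "r = min ra rb"
  have r: "r > 0" "ball u0 r \<subseteq> ball u0 ra" "ball u0 r \<subseteq> ball u0 rb" using ra(1) rb(1) by (auto simp: r_def)
  obtain r2 r3 \<phi> \<psi> where s: "r2 > 0" "r2 \<le> r" "r3 > 0" "\<psi> vh = u0"
    "\<And>v. v \<in> ball vh r3 \<Longrightarrow> \<psi> v \<in> ball u0 r2"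
    "\<And>v. v \<in> ball vh r3 \<Longrightarrow> grad_pot \<epsilon> (\<psi> v) = v"
    "\<And>v. v \<in> ball vh r3 \<Longrightarrow> \<exists>D'. (\<psi> has_derivative D') (at v) \<and> (\<forall>h. hess_pot \<epsilon> (\<psi> v) (D' h) = h)"
    "\<And>v p. \<lbrakk>v \<in> ball vh r3; p \<in> ball u0 r2\<rbrakk> \<Longrightarrow> \<phi> (v + K *\<^sub>R p) \<in> ball u0 r"
    "\<And>v p. \<lbrakk>v \<in> ball vh r3; p \<in> ball u0 r2\<rbrakk> \<Longrightarrow>
      (SUP v0\<in>B. ereal (Js v v0 p)) = ereal (primal v p (\<phi> (v + K *\<^sub>R p)))"
    "\<And>v. v \<in> ball vh r3 \<Longrightarrow> \<phi> (v + K *\<^sub>R \<psi> v) = \<psi> v"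
    by (rule local_dual_setup[OF crit u0 UnI1[OF pos\<epsilon>] r(1), folded vh_def]) (rule that)
  define J3 where "J3 v = primal v (\<psi> v) (\<psi> v)" for v
  have \<psi>r: "\<psi> v \<in> ball u0 r" if "v \<in> ball vh r3" for v using s(5)[OF that] s(2) by auto
  have J3: "(INF p\<in>ball u0 r2. SUP v0\<in>B. ereal (Js v v0 p)) = ereal (J3 v)" if v: "v \<in> ball vh r3" for v
  proof (rule antisym)
    show "(INF p\<in>ball u0 r2. SUP v0\<in>B. ereal (Js v v0 p)) \<le> ereal (J3 v)"
      by (rule INF_lower2[OF s(5)[OF v]]) (simp add: s(9)[OF v s(5)[OF v]] s(10)[OF v] J3_def)
    show "ereal (J3 v) \<le> (INF p\<in>ball u0 r2. SUP v0\<in>B. ereal (Js v v0 p))"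
    proof (rule INF_greatest)
      fix p assume p: "p \<in> ball u0 r2"
      let ?u = "\<phi> (v + K *\<^sub>R p)"
      have "\<exists>y\<in>Pos. pot \<epsilon> ?u = pot \<epsilon> (\<psi> v) + L2 (grad_pot \<epsilon> (\<psi> v)) (?u - \<psi> v) + 1 / 2 * quad y (?u - \<psi> v)"
        using r(3) \<psi>r[OF v] s(8)[OF v p] by (intro rb(2)) auto
      then obtain y where y: "y \<in> Pos"
        "pot \<epsilon> ?u = pot \<epsilon> (\<psi> v) + L2 (grad_pot \<epsilon> (\<psi> v)) (?u - \<psi> v) + 1 / 2 * quad y (?u - \<psi> v)"
        by blast
      have "J3 v \<le> primal v ?u ?u"
        using pot_primal_step[OF s(6)[OF v] y(2)] quad_Pos[OF y(1), of "?u - \<psi> v"] by (simp add: J3_def)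
      also have "\<dots> \<le> primal v p ?u" by (rule primal_ge_diag)
      finally show "ereal (J3 v) \<le> (SUP v0\<in>B. ereal (Js v v0 p))" by (simp add: s(9)[OF v p])
    qed
  qed
  have J3_ge: "J u0 \<le> J3 v" if "v \<in> ball vh r3" for v
    using order_trans[OF J_min energy_le_primal] \<psi>r[OF that] r(2) unfolding J3_def by blast
  have J3_vh: "J3 vh = J u0" by (simp add: J3_def s(4)) (simp add: vh_def primal_critical)
  have i1: "ereal (J u0) = (INF u\<in>ball u0 ra. ereal (J u))"
  proof (rule INF_eqI[symmetric])
    show "z \<le> ereal (J u0)" if "\<And>u. u \<in> ball u0 ra \<Longrightarrow> z \<le> ereal (J u)" for z
      using that[of u0] ra(1) by simp
  qed (use J_min in simp)
  have i2: "ereal (J u0) = (INF v\<in>ball vh r3. ereal (J3 v))"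
  proof (rule INF_eqI[symmetric])
    show "z \<le> ereal (J u0)" if "\<And>v. v \<in> ball vh r3 \<Longrightarrow> z \<le> ereal (J3 v)" for z
      using that[of vh] s(3) by (simp add: J3_vh)
  qed (use J3_ge in simp)
  have i3: "(INF v\<in>ball vh r3. INF p\<in>ball u0 r2. SUP v0\<in>B. ereal (Js v v0 p)) = (INF v\<in>ball vh r3. ereal (J3 v))"
    by (intro INF_cong refl J3)
  have var: "first_variation_zero J3 vh" "second_variation_pos J3 vh"
    using reduced_dual_variations[OF crit s(3), folded vh_def, OF s(4,6,7)] pos unfolding J3_def by auto
  show ?thesis
    unfolding vh_def[symmetric]
    by (rule exI[of _ ra], rule conjI[OF ra(1)], rule exI[of _ r2], rule conjI[OF s(1)],
        rule exI[of _ r3], rule conjI[OF s(3)], intro conjI exI[of _ J3] i1 i2 var)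
      (simp_all add: i3 i2[symmetric] J3 J3_vh critical_J_star(2)[OF crit u0, folded vh_def])
qed

text \<open>Now \<open>pot \<epsilon>\<close> is locally concave, so \<open>\<psi> v\<close>
  maximizes the diagonal values. The outer problem is still a minimum: testing with
  \<open>p = u0\<close> gives \<open>J u0 \<le> primal v u0 u0 \<le> J5 v\<close>.\<close>

lemma duality_local_max:
  assumes crit: "grad_pot 0 u0 = f" and u0: "v0_of u0 \<in> B" and neg: "hess_weight \<epsilon> u0 \<in> Neg"
  shows "\<exists>r1>0. \<exists>r2>0. \<exists>r3>0.
    ereal (J u0) = (SUP u\<in>ball u0 r1. ereal (J u)) \<and>
    ereal (J u0) = (INF v\<in>ball (\<epsilon> *\<^sub>R u0 + f) r3. SUP p\<in>ball u0 r2. SUP v0\<in>B. ereal (Js v v0 p)) \<and>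
    J u0 = Js (\<epsilon> *\<^sub>R u0 + f) (v0_of u0) u0 \<and>
    (\<exists>J5. (\<forall>v\<in>ball (\<epsilon> *\<^sub>R u0 + f) r3. ereal (J5 v) = (SUP p\<in>ball u0 r2. SUP v0\<in>B. ereal (Js v v0 p))) \<and>
      first_variation_zero J5 (\<epsilon> *\<^sub>R u0 + f) \<and> second_variation_pos J5 (\<epsilon> *\<^sub>R u0 + f) \<and>
      ereal (J u0) = (INF v\<in>ball (\<epsilon> *\<^sub>R u0 + f) r3. ereal (J5 v)) \<and>
      J u0 = J5 (\<epsilon> *\<^sub>R u0 + f))"
proof -
  define vh where "vh = \<epsilon> *\<^sub>R u0 + f"
  have neg0: "hess_weight 0 u0 \<in> Neg"
  proof -
    have "quad (hess_weight 0 u0) u \<le> quad (hess_weight \<epsilon> u0) u" for u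
      using \<epsilon>_pos l2_pos[OF disc] by (simp add: hess_weight_shift[of \<epsilon>] quad_shift)
    then show ?thesis using neg by (fastforce simp: Neg_def intro: le_less_trans)
  qed
  obtain ra where ra: "ra > 0" "\<And>p u. \<lbrakk>p \<in> ball u0 ra; u \<in> ball u0 ra\<rbrakk> \<Longrightarrow>
    \<exists>y\<in>Neg. pot 0 u = pot 0 p + L2 (grad_pot 0 p) (u - p) + 1 / 2 * quad y (u - p)"
    using taylor_neighbourhood[OF open_Neg neg0] by blast
  obtain rb where rb: "rb > 0" "\<And>p u. \<lbrakk>p \<in> ball u0 rb; u \<in> ball u0 rb\<rbrakk> \<Longrightarrow>
    \<exists>y\<in>Neg. pot \<epsilon> u = pot \<epsilon> p + L2 (grad_pot \<epsilon> p) (u - p) + 1 / 2 * quad y (u - p)"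
    using taylor_neighbourhood[OF open_Neg neg] by blast
  have J_max: "J u \<le> J u0" if u: "u \<in> ball u0 ra" for u
  proof -
    obtain y where y: "y \<in> Neg" "pot 0 u = pot 0 u0 + L2 (grad_pot 0 u0) (u - u0) + 1 / 2 * quad y (u - u0)"
      using ra(2)[of u0 u] ra(1) u by auto
    show ?thesis using pot_energy_step[OF crit y(2)] quad_Neg[OF y(1), of "u - u0"] by simp
  qed
  obtain r2 r3 \<phi> \<psi> where s: "r2 > 0" "r2 \<le> rb" "r3 > 0" "\<psi> vh = u0"
    "\<And>v. v \<in> ball vh r3 \<Longrightarrow> \<psi> v \<in> ball u0 r2"
    "\<And>v. v \<in> ball vh r3 \<Longrightarrow> grad_pot \<epsilon> (\<psi> v) = v"
    "\<And>v. v \<in> ball vh r3 \<Longrightarrow> \<exists>D'. (\<psi> has_derivative D') (at v) \<and> (\<forall>h. hess_pot \<epsilon> (\<psi> v) (D' h) = h)"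
    "\<And>v p. \<lbrakk>v \<in> ball vh r3; p \<in> ball u0 r2\<rbrakk> \<Longrightarrow> \<phi> (v + K *\<^sub>R p) \<in> ball u0 rb"
    "\<And>v p. \<lbrakk>v \<in> ball vh r3; p \<in> ball u0 r2\<rbrakk> \<Longrightarrow>
      (SUP v0\<in>B. ereal (Js v v0 p)) = ereal (primal v p (\<phi> (v + K *\<^sub>R p)))"
    "\<And>v. v \<in> ball vh r3 \<Longrightarrow> \<phi> (v + K *\<^sub>R \<psi> v) = \<psi> v"
    by (rule local_dual_setup[OF crit u0 UnI2[OF neg] rb(1), folded vh_def]) (rule that)
  define J5 where "J5 v = primal v (\<psi> v) (\<psi> v)" for v
  have diag_le: "primal v p p \<le> J5 v" if v: "v \<in> ball vh r3" and p: "p \<in> ball u0 r2" for v p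
  proof -
    have "\<exists>y\<in>Neg. pot \<epsilon> p = pot \<epsilon> (\<psi> v) + L2 (grad_pot \<epsilon> (\<psi> v)) (p - \<psi> v) + 1 / 2 * quad y (p - \<psi> v)"
      using s(5)[OF v] s(2) p by (intro rb(2)) auto
    then obtain y where y: "y \<in> Neg"
      "pot \<epsilon> p = pot \<epsilon> (\<psi> v) + L2 (grad_pot \<epsilon> (\<psi> v)) (p - \<psi> v) + 1 / 2 * quad y (p - \<psi> v)"
      by blast
    then show ?thesis
      using pot_primal_step[OF s(6)[OF v] y(2)] quad_Neg[OF y(1), of "p - \<psi> v"] by (simp add: J5_def)
  qed
  have J5: "(SUP p\<in>ball u0 r2. SUP v0\<in>B. ereal (Js v v0 p)) = ereal (J5 v)" if v: "v \<in> ball vh r3" for v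
  proof (rule antisym)
    show "ereal (J5 v) \<le> (SUP p\<in>ball u0 r2. SUP v0\<in>B. ereal (Js v v0 p))"
      by (rule SUP_upper2[OF s(5)[OF v]]) (simp add: s(9)[OF v s(5)[OF v]] s(10)[OF v] J5_def)
    show "(SUP p\<in>ball u0 r2. SUP v0\<in>B. ereal (Js v v0 p)) \<le> ereal (J5 v)"
    proof (intro SUP_least)
      fix p v0 assume p: "p \<in> ball u0 r2" and "v0 \<in> B"
      \<comment> \<open>Choosing the free point of the majorant to be \<open>p\<close> itself
        removes the penalty \<open>K / 2 * L2 (u - p) (u - p)\<close>.\<close>
      then have "Js v v0 p \<le> primal v p p" by (intro J_star_le_primal)
      then show "ereal (Js v v0 p) \<le> ereal (J5 v)" using diag_le[OF v p] by simp
    qed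
  qed
  have J5_ge: "J u0 \<le> J5 v" if "v \<in> ball vh r3" for v
    using diag_le[OF that, of u0] s(1) energy_le_primal[of u0 v u0] by simp
  have J5_vh: "J5 vh = J u0" by (simp add: J5_def s(4)) (simp add: vh_def primal_critical)
  have i1: "ereal (J u0) = (SUP u\<in>ball u0 ra. ereal (J u))"
  proof (rule SUP_eqI[symmetric])
    show "ereal (J u0) \<le> z" if "\<And>u. u \<in> ball u0 ra \<Longrightarrow> ereal (J u) \<le> z" for z
      using that[of u0] ra(1) by simp
  qed (use J_max in simp)
  have i2: "ereal (J u0) = (INF v\<in>ball vh r3. ereal (J5 v))"
  proof (rule INF_eqI[symmetric])
    show "z \<le> ereal (J u0)" if "\<And>v. v \<in> ball vh r3 \<Longrightarrow> z \<le> ereal (J5 v)" for z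
      using that[of vh] s(3) by (simp add: J5_vh)
  qed (use J5_ge in simp)
  have i3: "(INF v\<in>ball vh r3. SUP p\<in>ball u0 r2. SUP v0\<in>B. ereal (Js v v0 p)) = (INF v\<in>ball vh r3. ereal (J5 v))"
    by (intro INF_cong refl J5)
  have var: "first_variation_zero J5 vh" "second_variation_pos J5 vh"
    using reduced_dual_variations[OF crit s(3), folded vh_def, OF s(4,6,7)] neg unfolding J5_def by auto
  show ?thesis
    unfolding vh_def[symmetric]
    by (rule exI[of _ ra], rule conjI[OF ra(1)], rule exI[of _ r2], rule conjI[OF s(1)],
        rule exI[of _ r3], rule conjI[OF s(3)], intro conjI exI[of _ J5] i1 i2 var)
      (simp_all add: i3 i2[symmetric] J5 J5_vh critical_J_star(2)[OF crit u0, folded vh_def])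
qed

section \<open>Global duality for a multiplier in the positive cone\<close>

text \<open>With the multiplier frozen at its critical value the Lagrangian is quadratic in \<open>u\<close>.\<close>

lemma lagrangian_quadratic:
  assumes crit: "grad_pot 0 u0 = f"
  shows "J u - 1 / (2 * \<alpha>) * L2 (v0_of u0 - v0_of u) (v0_of u0 - v0_of u)
    = J u0 + 1 / 2 * quad (v0_of u0) (u - u0)"
proof -
  define d where "d = u - u0"
  have u: "u = u0 + d" by (simp add: d_def)
  define y where "y = \<alpha> *\<^sub>R ((1/2) *\<^sub>R (3 *\<^sub>R (u0 * u0) + 2 *\<^sub>R (u0 * u) + u * u) - vec \<beta>) + vec (0 / 2)"
  have "L2 (y * d) d - L2 (v0_of u0 * d) d = 1 / (2 * \<alpha>) * L2 (v0_of u0 - v0_of u) (v0_of u0 - v0_of u)"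
    unfolding l2_def integ_simps(3)[symmetric] integ_simps(2)[symmetric]
    by (rule arg_cong[of _ _ "integ S"])
      (use \<alpha>_pos in \<open>simp add: vec_eq_iff y_def u power2_eq_square field_simps\<close>)
  then have "quad y d = quad (v0_of u0) d + 2 * (1 / (2 * \<alpha>) * L2 (v0_of u0 - v0_of u) (v0_of u0 - v0_of u))"
    unfolding quad_def by linarith
  with pot_energy_step[OF crit pot_taylor[of 0 u u0]] show ?thesis
    unfolding y_def[symmetric] d_def[symmetric] by linarith
qed

text \<open>At the critical multiplier, the point \<open>u\<close> with zero residual turns the
  decomposition into the Lagrangian plus nonnegative penalties. The Lagrangian is at least
  \<open>J u0\<close> because its quadratic part is positive.\<close>

lemma J_star_lower:
  assumes crit: "grad_pot 0 u0 = f" and u0: "v0_of u0 \<in> Pos \<inter> B"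
  shows "J u0 \<le> Js v (v0_of u0) p"
proof -
  have B: "v0_of u0 \<in> B" using u0 by simp
  define u where "u = matrix_inv (M (v0_of u0)) *v (v + K *\<^sub>R p)"
  have "v + K *\<^sub>R p - M (v0_of u0) *v u = 0" by (simp add: u_def M_inverse[OF B])
  then have "Js v (v0_of u0) p = primal v p u - 1 / (2 * \<alpha>) * L2 (v0_of u0 - v0_of u) (v0_of u0 - v0_of u)"
    using J_star_decomp[OF B, of v p u] by simp
  moreover have "0 \<le> quad (v0_of u0) (u - u0)" using u0 quad_Pos by blast
  ultimately show ?thesis
    using lagrangian_quadratic[OF crit, of u] energy_le_primal[of u v p] by linarith
qed

text \<open>Up to terms quadratic in \<open>v\<close> and in \<open>p\<close>, the value is minus a
  conjugate at \<open>v + K *\<^sub>R p\<close>, so the envelope formula gives its gradient.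
  Positivity of the joint Hessian comes from completing squares around \<open>m\<close>, the
  response of \<open>\<phi>\<close> to the increment.\<close>

lemma primal_value_variations:
  assumes crit: "grad_pot 0 u0 = f" and pos: "hess_weight 0 u0 \<in> Pos" and "\<delta> > 0"
    and \<phi>0: "\<phi> ((\<epsilon> *\<^sub>R u0 + f) + K *\<^sub>R u0) = u0"
    and \<phi>: "\<And>z. z \<in> ball ((\<epsilon> *\<^sub>R u0 + f) + K *\<^sub>R u0) \<delta> \<Longrightarrow> grad_pot (K + \<epsilon>) (\<phi> z) = z"
      "\<And>z. z \<in> ball ((\<epsilon> *\<^sub>R u0 + f) + K *\<^sub>R u0) \<delta> \<Longrightarrow>
        \<exists>D'. (\<phi> has_derivative D') (at z) \<and> (\<forall>h. hess_pot (K + \<epsilon>) (\<phi> z) (D' h) = h)"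
    and J7: "\<And>v p. v + K *\<^sub>R p \<in> ball ((\<epsilon> *\<^sub>R u0 + f) + K *\<^sub>R u0) \<delta> \<Longrightarrow>
      J7 (v, p) = primal v p (\<phi> (v + K *\<^sub>R p))"
  shows "first_variation_zero J7 (\<epsilon> *\<^sub>R u0 + f, u0)"
    and "second_variation_pos J7 (\<epsilon> *\<^sub>R u0 + f, u0)"
proof -
  define w where "w = (\<chi> i. wt S i)"
  define vh where "vh = \<epsilon> *\<^sub>R u0 + f"
  define zh where "zh = vh + K *\<^sub>R u0"
  define a where "a x = fst x + K *\<^sub>R snd x" for x :: "(real^'n) \<times> (real^'n)"
  have a: "(a has_derivative a) (at x)" for x
    unfolding a_def by (auto intro!: derivative_eq_intros)
  define X where "X = a -` ball zh \<delta>"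
  have "continuous_on UNIV a" unfolding a_def by (intro continuous_intros)
  then have X: "open X" "(vh, u0) \<in> X"
    using \<open>\<delta> > 0\<close> by (auto simp: X_def a_def zh_def intro: open_vimage)
  define g where "g x = (w * ((1 / \<epsilon>) *\<^sub>R (fst x - f) - \<phi> (a x)), w * (K *\<^sub>R (snd x - \<phi> (a x))))" for x
  have der: "(J7 has_derivative (\<lambda>h. g x \<bullet> h)) (at x)" if x: "x \<in> X" for x
  proof -
    have ax: "a x \<in> ball zh \<delta>" using x by (simp add: X_def)
    obtain D' where D': "(\<phi> has_derivative D') (at (a x))"
      using \<phi>(2) ax unfolding zh_def vh_def by blast
    have d0: "((\<lambda>x. pot (K + \<epsilon>) (\<phi> (a x)) - L2 (\<phi> (a x)) (a x)) has_derivative (\<lambda>h. - L2 (\<phi> (a x)) (a h))) (at x)"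
      using has_derivative_compose[OF a value_has_derivative[OF D' \<phi>(1)[OF ax[unfolded zh_def vh_def]]]] .
    have d1: "((\<lambda>x. fst x - f) has_derivative fst) (at x)" by (auto intro!: derivative_eq_intros)
    have d2: "(snd has_derivative snd) (at x)" by (auto intro!: derivative_eq_intros)
    note bl = bounded_bilinear.FDERIV[OF bounded_bilinear_l2[of S]]
    have "((\<lambda>x. pot (K + \<epsilon>) (\<phi> (a x)) - L2 (\<phi> (a x)) (a x)
        + (1 / (2 * \<epsilon>) * L2 (fst x - f) (fst x - f) + K / 2 * L2 (snd x) (snd x))) has_derivative
      (\<lambda>h. - L2 (\<phi> (a x)) (a h) + (1 / (2 * \<epsilon>) * (L2 (fst x - f) (fst h) + L2 (fst h) (fst x - f))
        + K / 2 * (L2 (snd x) (snd h) + L2 (snd h) (snd x))))) (at x)"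
      by (intro has_derivative_add has_derivative_mult_right d0 bl d1 d2)
    moreover have "- L2 (\<phi> (a x)) (a h) + (1 / (2 * \<epsilon>) * (L2 (fst x - f) (fst h) + L2 (fst h) (fst x - f))
        + K / 2 * (L2 (snd x) (snd h) + L2 (snd h) (snd x))) = g x \<bullet> h" for h
      unfolding g_def w_def inner_prod_def fst_conv snd_conv l2_eq_inner[symmetric]
        l2_commute[of S "fst h" "fst x - f"] l2_commute[of S "snd h" "snd x"]
      using \<epsilon>_pos by (simp add: a_def l2_simps field_simps)
    ultimately have "((\<lambda>x. pot (K + \<epsilon>) (\<phi> (a x)) - L2 (\<phi> (a x)) (a x)
        + (1 / (2 * \<epsilon>) * L2 (fst x - f) (fst x - f) + K / 2 * L2 (snd x) (snd x))) has_derivative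
      (\<lambda>h. g x \<bullet> h)) (at x)" by simp
    then show ?thesis
    proof (rule has_derivative_transform_within_open[OF _ X(1) x])
      fix y assume "y \<in> X"
      then have "fst y + K *\<^sub>R snd y \<in> ball (\<epsilon> *\<^sub>R u0 + f + K *\<^sub>R u0) \<delta>"
        by (simp add: X_def a_def zh_def vh_def)
      from J7[OF this]
      show "pot (K + \<epsilon>) (\<phi> (a y)) - L2 (\<phi> (a y)) (a y)
        + (1 / (2 * \<epsilon>) * L2 (fst y - f) (fst y - f) + K / 2 * L2 (snd y) (snd y)) = J7 y"
        by (simp add: primal_eq a_def)
    qed
  qed
  have ah: "a (vh, u0) = zh" by (simp add: a_def zh_def)
  have \<phi>h: "\<phi> zh = u0" using \<phi>0 by (simp add: zh_def vh_def)
  have "g (vh, u0) = 0" using \<epsilon>_pos by (simp add: g_def ah \<phi>h) (simp add: vh_def zero_prod_def)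
  then show "first_variation_zero J7 (\<epsilon> *\<^sub>R u0 + f, u0)"
    using der[OF X(2)] by (simp add: first_variation_zero_def vh_def)
  have zh: "zh \<in> ball zh \<delta>" using \<open>\<delta> > 0\<close> by simp
  obtain D' where D': "(\<phi> has_derivative D') (at zh)" "\<And>h. hess_pot (K + \<epsilon>) u0 (D' h) = h"
    using \<phi>(2)[OF zh[unfolded zh_def vh_def]] \<phi>h unfolding zh_def vh_def by metis
  define Hs where "Hs h = (w * ((1 / \<epsilon>) *\<^sub>R fst h - D' (a h)), w * (K *\<^sub>R (snd h - D' (a h))))" for h
  have d\<phi>: "((\<lambda>x. \<phi> (a x)) has_derivative (\<lambda>h. D' (a h))) (at (vh, u0))"
    using has_derivative_compose[OF a, of \<phi> D' "(vh, u0)"] D'(1) by (simp add: ah)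
  have "(g has_derivative Hs) (at (vh, u0))"
    unfolding g_def Hs_def
    by (intro has_derivative_Pair bounded_linear.has_derivative[OF bounded_bilinear.bounded_linear_right[OF
        bounded_bilinear_vec_times]]) (auto intro!: derivative_eq_intros d\<phi>)
  moreover have "\<forall>\<^sub>F y in nhds (vh, u0). (J7 has_derivative (\<lambda>h. g y \<bullet> h)) (at y)"
    using eventually_nhds_in_open[OF X] by eventually_elim (rule der)
  ultimately have hess: "has_hessian J7 Hs (vh, u0)" by (auto simp: has_hessian_def)
  have "0 < Hs h \<bullet> h" if "h \<noteq> 0" for h
  proof -
    define m where "m = D' (a h)"
    have eq: "Hs h \<bullet> h = 1 / \<epsilon> * L2 (fst h) (fst h) + K * L2 (snd h) (snd h) - L2 m (a h)"
      unfolding Hs_def w_def inner_prod_def fst_conv snd_conv l2_eq_inner[symmetric] m_def[symmetric]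
      by (simp add: a_def l2_simps algebra_simps)
    have ahm: "a h = hess_pot 0 u0 m + (K + \<epsilon>) *\<^sub>R m"
      using D'(2)[of "a h"] by (simp add: m_def hess_pot_shift[of "K + \<epsilon>"])
    have "L2 m (a h) = quad (hess_weight 0 u0) m + (K + \<epsilon>) * L2 m m"
      unfolding L2_hess_pot_self[symmetric] ahm by (simp add: l2_simps l2_commute[of S m "hess_pot 0 u0 m"])
    moreover have "L2 m (a h) = L2 m (fst h) + K * L2 m (snd h)" by (simp add: a_def l2_simps)
    ultimately have q: "quad (hess_weight 0 u0) m = L2 m (fst h) + K * L2 m (snd h) - (K + \<epsilon>) * L2 m m"
      by linarith
    have sq: "Hs h \<bullet> h = 1 / \<epsilon> * L2 (fst h - \<epsilon> *\<^sub>R m) (fst h - \<epsilon> *\<^sub>R m)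
        + K * L2 (snd h - m) (snd h - m) + quad (hess_weight 0 u0) m"
      unfolding eq q using \<epsilon>_pos
      by (simp add: a_def l2_simps l2_commute[of S "fst h" m] l2_commute[of S "snd h" m] field_simps)
    have nn: "0 \<le> 1 / \<epsilon> * L2 (fst h - \<epsilon> *\<^sub>R m) (fst h - \<epsilon> *\<^sub>R m)" "0 \<le> K * L2 (snd h - m) (snd h - m)"
      using \<epsilon>_pos K_pos l2_pos[OF disc] by simp_all
    show ?thesis
    \<comment> \<open>For nonzero \<open>m\<close> the energy Hessian is strictly positive; for
      \<open>m = 0\<close> the squares reduce to those of the two components of
      \<open>h\<close>.\<close>
    proof (cases "m = 0")
      case False
      then have "0 < quad (hess_weight 0 u0) m" using pos by (simp add: Pos_def)
      then show ?thesis unfolding sq using nn by linarith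
    next
      case True
      have "fst h \<noteq> 0 \<or> snd h \<noteq> 0" using that by (auto simp: prod_eq_iff)
      then have "0 < 1 / \<epsilon> * L2 (fst h) (fst h) \<or> 0 < K * L2 (snd h) (snd h)"
        using \<epsilon>_pos K_pos l2_nondegenerate[OF disc] by (meson divide_pos_pos mult_pos_pos zero_less_one)
      moreover have "Hs h \<bullet> h = 1 / \<epsilon> * L2 (fst h) (fst h) + K * L2 (snd h) (snd h)"
        unfolding eq by (simp add: True)
      ultimately show ?thesis using nn unfolding True by auto
    qed
  qed
  then show "second_variation_pos J7 (\<epsilon> *\<^sub>R u0 + f, u0)"
    using hess unfolding second_variation_pos_def vh_def by blast
qed

text \<open>The lower bound \<open>J u0\<close> holds for all pairs and is attained at the critical
  pair. The explicit formula through \<open>\<phi>\<close> is available only near that pair, which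
  suffices for the variations.\<close>

lemma duality_global_min:
  assumes crit: "grad_pot 0 u0 = f" and u0: "v0_of u0 \<in> Pos \<inter> B"
  shows "ereal (J u0) = (INF u. ereal (J u))"
    and "ereal (J u0) = (INF (v, p)\<in>UNIV. SUP v0\<in>Pos \<inter> B. ereal (Js v v0 p))"
    and "\<exists>J7. (\<forall>v p. ereal (J7 (v, p)) = (SUP v0\<in>Pos \<inter> B. ereal (Js v v0 p))) \<and>
      first_variation_zero J7 (\<epsilon> *\<^sub>R u0 + f, u0) \<and> second_variation_pos J7 (\<epsilon> *\<^sub>R u0 + f, u0) \<and>
      ereal (J u0) = (INF z. ereal (J7 z)) \<and> J u0 = J7 (\<epsilon> *\<^sub>R u0 + f, u0)"
proof -
  define vh where "vh = \<epsilon> *\<^sub>R u0 + f"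
  note gc = grad_pot_critical[OF crit, folded vh_def]
  have J_min: "J u0 \<le> J u" for u
  proof -
    have "0 \<le> quad (v0_of u0) (u - u0)" using u0 quad_Pos by blast
    moreover have "0 \<le> 1 / (2 * \<alpha>) * L2 (v0_of u0 - v0_of u) (v0_of u0 - v0_of u)"
      using \<alpha>_pos l2_pos[OF disc] by simp
    ultimately show ?thesis using lagrangian_quadratic[OF crit, of u] by linarith
  qed
  then show "ereal (J u0) = (INF u. ereal (J u))"
    by (intro INF_eqI[symmetric]) auto
  \<comment> \<open>The conversion to a real loses nothing: the supremum lies between
    \<open>J u0\<close> and \<open>primal v p u0\<close>.\<close>
  define J7 where "J7 x = real_of_ereal (SUP v0\<in>Pos \<inter> B. ereal (Js (fst x) v0 (snd x)))" for x
  have lower: "ereal (J u0) \<le> (SUP v0\<in>Pos \<inter> B. ereal (Js v v0 p))" for v p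
    using J_star_lower[OF crit u0] u0 by (intro SUP_upper2[of "v0_of u0"]) auto
  have upper: "(SUP v0\<in>Pos \<inter> B. ereal (Js v v0 p)) \<le> ereal (primal v p u)" for v p u
    using J_star_le_primal by (intro SUP_least) auto
  have J7: "ereal (J7 (v, p)) = (SUP v0\<in>Pos \<inter> B. ereal (Js v v0 p))" for v p
    using lower[of v p] upper[of v p u0] unfolding J7_def fst_conv snd_conv
    by (intro ereal_real') auto
  have J7_ge: "J u0 \<le> J7 x" for x
    using lower[of "fst x" "snd x", folded J7] by simp
  have "continuous_on UNIV v0_of"
    unfolding power2_eq_square
    by (intro continuous_intros bounded_bilinear.continuous_on[OF bounded_bilinear_vec_times])
  then have W: "open (v0_of -` (Pos \<inter> B))" "u0 \<in> v0_of -` (Pos \<inter> B)"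
    using u0 open_vimage[OF open_Int[OF open_Pos open_B]] by auto
  have uB: "v0_of u0 \<in> B" using u0 by simp
  obtain U \<phi> \<delta> where U: "open U" "u0 \<in> U" "U \<subseteq> v0_of -` (Pos \<inter> B)" "\<delta> > 0"
    "\<And>x. x \<in> U \<Longrightarrow> \<phi> (grad_pot (K + \<epsilon>) x) = x"
    "\<And>z. z \<in> ball (vh + K *\<^sub>R u0) \<delta> \<Longrightarrow> \<phi> z \<in> U"
    "\<And>z. z \<in> ball (vh + K *\<^sub>R u0) \<delta> \<Longrightarrow> grad_pot (K + \<epsilon>) (\<phi> z) = z"
    "\<And>z. z \<in> ball (vh + K *\<^sub>R u0) \<delta> \<Longrightarrow>
      \<exists>D'. (\<phi> has_derivative D') (at z) \<and> (\<forall>h. hess_pot (K + \<epsilon>) (\<phi> z) (D' h) = h)"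
    by (rule local_inverse_grad_pot[OF UnI1[OF hess_weight_Pos[OF uB]] W, unfolded gc]) (rule that)
  have \<phi>0: "\<phi> (vh + K *\<^sub>R u0) = u0" using U(5)[OF U(2)] by (simp add: gc)
  have J7_local: "J7 (v, p) = primal v p (\<phi> (v + K *\<^sub>R p))" if "v + K *\<^sub>R p \<in> ball (vh + K *\<^sub>R u0) \<delta>" for v p
  proof -
    have "v0_of (\<phi> (v + K *\<^sub>R p)) \<in> Pos \<inter> B" using U(3) U(6)[OF that] by auto
    then have "(SUP v0\<in>Pos \<inter> B. ereal (Js v v0 p)) = ereal (primal v p (\<phi> (v + K *\<^sub>R p)))"
      by (intro SUP_J_star Int_lower2 U(7)[OF that])
    then show ?thesis using J7[of v p] by simp
  qed
  have J7h: "J7 (vh, u0) = J u0"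
  proof -
    have "J7 (vh, u0) = primal vh u0 u0" using J7_local[of vh u0] U(4) by (simp add: \<phi>0)
    then show ?thesis by (simp add: vh_def primal_critical)
  qed
  have INF7: "ereal (J u0) = (INF z. ereal (J7 z))"
  proof (rule INF_eqI[symmetric])
    show "y \<le> ereal (J u0)" if "\<And>z. z \<in> UNIV \<Longrightarrow> y \<le> ereal (J7 z)" for y
      using that[of "(vh, u0)"] by (simp add: J7h)
  qed (simp add: J7_ge)
  also have "(INF z. ereal (J7 z)) = (INF (v, p)\<in>UNIV. SUP v0\<in>Pos \<inter> B. ereal (Js v v0 p))"
    by (rule INF_cong) (auto simp: J7)
  finally show "ereal (J u0) = (INF (v, p)\<in>UNIV. SUP v0\<in>Pos \<inter> B. ereal (Js v v0 p))" .
  \<comment> \<open>The Hessian weight exceeds the multiplier entrywise by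
    \<open>2 * \<alpha> * (u0 $ i)\<^sup>2\<close>.\<close>
  have pos: "hess_weight 0 u0 \<in> Pos"
  proof (rule Pos_mono)
    show "v0_of u0 \<in> Pos" using u0 by simp
    show "v0_of u0 $ i \<le> hess_weight 0 u0 $ i" for i
      using \<alpha>_pos by (simp add: hess_weight_def power2_eq_square)
  qed
  have "first_variation_zero J7 (vh, u0)" "second_variation_pos J7 (vh, u0)"
    using primal_value_variations[OF crit pos U(4), folded vh_def, OF \<phi>0 U(7,8) J7_local] by auto
  then show "\<exists>J7. (\<forall>v p. ereal (J7 (v, p)) = (SUP v0\<in>Pos \<inter> B. ereal (Js v v0 p))) \<and>
      first_variation_zero J7 (\<epsilon> *\<^sub>R u0 + f, u0) \<and> second_variation_pos J7 (\<epsilon> *\<^sub>R u0 + f, u0) \<and>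
      ereal (J u0) = (INF z. ereal (J7 z)) \<and> J u0 = J7 (\<epsilon> *\<^sub>R u0 + f, u0)"
    using J7 INF7 J7h[symmetric] unfolding vh_def by (intro exI[of _ J7] conjI allI)
qed

end

section \<open>Assembly of the three duality statements for a uniform range of \<epsilon>\<close>

theorem theorem2p1:
  fixes \<Omega> :: "(real^3) set" and \<alpha> \<beta> \<gamma> K :: real and f :: "real^3 \<Rightarrow> real"
    and S :: "('n::finite, 'm::finite) scheme"
  assumes "open \<Omega>" and "bounded \<Omega>" and "connected \<Omega>" and "lipschitz_boundary \<Omega>"
    and "\<alpha> > 0" and "\<beta> > 0" and "\<gamma> > 0" and "K > 0"
    and "C1_closure \<Omega> f"
    and "discretization \<Omega> S"
  shows "\<exists>\<epsilon>0>0. \<forall>\<epsilon>. 0 < \<epsilon> \<and> \<epsilon> < \<epsilon>0 \<longrightarrow> (\<forall>u0 :: real^'n.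
    (let fh = nodal S f;
         J = energy S \<alpha> \<beta> \<gamma> K fh;
         Js = J_star S \<alpha> \<beta> \<gamma> K fh \<epsilon>;
         B = B_star S \<gamma> K \<epsilon>;
         A = A_plus S \<gamma>;
         v0h = \<alpha> *\<^sub>R (u0^2 - vec \<beta>);
         vh = \<epsilon> *\<^sub>R u0 + fh;
         ph = u0
     in first_variation_zero J u0 \<longrightarrow>
       (v0h \<in> B \<longrightarrow> first_variation_zero (\<lambda>(v, v0, p). Js v v0 p) (vh, v0h, ph)) \<and>

       (second_variation_pos J u0 \<and> v0h \<in> B \<longrightarrow>
         (\<exists>r1>0. \<exists>r2>0. \<exists>r3>0.
           ereal (J u0) = (INF u\<in>ball u0 r1. ereal (J u)) \<and>
           ereal (J u0) =
             (INF v\<in>ball vh r3. INF p\<in>ball ph r2. SUP v0\<in>B. ereal (Js v v0 p)) \<and>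
           J u0 = Js vh v0h ph \<and>
           (\<exists>J3 :: real^'n \<Rightarrow> real.
             (\<forall>v\<in>ball vh r3. ereal (J3 v) = (INF p\<in>ball ph r2. SUP v0\<in>B. ereal (Js v v0 p))) \<and>
             first_variation_zero J3 vh \<and> second_variation_pos J3 vh \<and>
             ereal (J u0) = (INF v\<in>ball vh r3. ereal (J3 v)) \<and>
             J u0 = J3 vh))) \<and>

       (second_variation_neg J u0 \<and> v0h \<in> B \<longrightarrow>
         (\<exists>r1>0. \<exists>r2>0. \<exists>r3>0.
           ereal (J u0) = (SUP u\<in>ball u0 r1. ereal (J u)) \<and>
           ereal (J u0) =
             (INF v\<in>ball vh r3. SUP p\<in>ball ph r2. SUP v0\<in>B. ereal (Js v v0 p)) \<and>
           J u0 = Js vh v0h ph \<and>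
           (\<exists>J5 :: real^'n \<Rightarrow> real.
             (\<forall>v\<in>ball vh r3. ereal (J5 v) = (SUP p\<in>ball ph r2. SUP v0\<in>B. ereal (Js v v0 p))) \<and>
             first_variation_zero J5 vh \<and> second_variation_pos J5 vh \<and>
             ereal (J u0) = (INF v\<in>ball vh r3. ereal (J5 v)) \<and>
             J u0 = J5 vh))) \<and>

       (v0h \<in> A \<inter> B \<longrightarrow>
         ereal (J u0) = (INF u. ereal (J u)) \<and>
         ereal (J u0) = (INF (v, p)\<in>UNIV. SUP v0\<in>A \<inter> B. ereal (Js v v0 p)) \<and>
         J u0 = Js vh v0h ph \<and>
         (\<exists>J7 :: (real^'n) \<times> (real^'n) \<Rightarrow> real.
           (\<forall>v p. ereal (J7 (v, p)) = (SUP v0\<in>A \<inter> B. ereal (Js v v0 p))) \<and>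
           first_variation_zero J7 (vh, ph) \<and> second_variation_pos J7 (vh, ph) \<and>
           ereal (J u0) = (INF z. ereal (J7 z)) \<and>
           J u0 = J7 (vh, ph)))))"

proof -
  interpret discrete_energy \<Omega> S \<alpha> \<beta> \<gamma> "nodal S f"
    using assms by unfold_locales auto
  \<comment> \<open>Fixed before \<epsilon> and \<open>u0\<close>, this threshold transfers
    negativity of the energy Hessian to the one shifted by \<epsilon>, as the local maximum case
    requires.\<close>
  obtain \<epsilon>0 where \<epsilon>0: "\<epsilon>0 > 0" "\<And>u \<epsilon>. \<lbrakk>grad_pot 0 u = nodal S f; hess_weight 0 u \<in> Neg; \<epsilon> < \<epsilon>0; 0 < \<epsilon>\<rbrakk>
      \<Longrightarrow> hess_weight \<epsilon> u \<in> Neg"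
    by (rule uniform_Neg_shift) (rule that)
  show ?thesis
    unfolding Let_def A_plus_eq
  proof (rule exI[of _ \<epsilon>0], rule conjI[OF \<epsilon>0(1)], intro allI impI, goal_cases)
    case (1 \<epsilon> u0)
    interpret dual_energy \<Omega> S \<alpha> \<beta> \<gamma> "nodal S f" K \<epsilon>
      using assms 1(1) by unfold_locales auto
    note crit = first_variation_zero_energy[OF 1(2)]
    show ?case
    proof (intro conjI impI, goal_cases)
      case 1
      then show ?case by (rule critical_J_star(1)[OF crit])
    next
      case 2
      then show ?case using duality_local_min[OF crit] second_variation_pos_energy by blast
    next
      case 3
      then have "hess_weight \<epsilon> u0 \<in> Neg"
        using \<epsilon>0(2)[OF crit second_variation_neg_energy] \<open>0 < \<epsilon> \<and> \<epsilon> < \<epsilon>0\<close> by blast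
      then show ?case using 3 duality_local_max[OF crit] by blast
    next
      case 4
      then show ?case by (rule duality_global_min(1)[OF crit])
    next
      case 5
      then show ?case by (rule duality_global_min(2)[OF crit])
    next
      case 6
      then show ?case using critical_J_star(2)[OF crit] by simp
    next
      case 7
      then show ?case by (rule duality_global_min(3)[OF crit])
    qed
  qed
qed

end
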